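(* Let $p(\cdot)$ be a finite range probability measure on $\mathbb{Z}^d$ with $p(0)=0$ such that $\{x\in\mathbb{Z}^d: p(x)+p(-x)>0\}$ generates the group $\mathbb{Z}^d$, and let $0\le\rho\le 1$. Let $L$ be the generator of the simple exclusion process associated to $p(\cdot)$, let $\mathcal{G}_\rho$, the Hilbert space of fluctuations $\mathcal{H}(\rho)$ and the normalized currents $w_1,\dots,w_d\in\mathcal{G}_\rho$ be as defined in the context, and let $D=(D_{ij})_{1\le i,j\le d}$ be the diffusion coefficient of the process, i.e. the matrix of coefficients (depending on $\rho$), whose existence follows from the decomposition of $\mathcal{H}(\rho)$ recalled in the context, such that for every $i\in\{1,\dots,d\}$ $$w_i-\sum_{j=1}^d D_{ij}\,(\xi(0)-\xi(e_j))\in\overline{L\mathcal{G}_\rho},$$ where the closure is taken in $\mathcal{H}(\rho)$. Then $D$ is always a symmetric matrix.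
   Context: State space: $\mathbb{X}=\{0,1\}^{\mathbb{Z}^d}$, with configurations $\xi=(\xi(x))_{x\in\mathbb{Z}^d}$; $e_1,\dots,e_d$ is the canonical basis of $\mathbb{Z}^d$. A local function is a real function on $\mathbb{X}$ depending on finitely many coordinates. Generator: on local functions $f$, $$Lf(\xi)=\sum_{x,y\in\mathbb{Z}^d}p(y-x)\,\xi(x)(1-\xi(y))\,(f(\xi^{x,y})-f(\xi)),$$ where $\xi^{x,y}$ is obtained from $\xi$ by exchanging the values at $x$ and $y$. Put $a(x)=\frac{p(x)+p(-x)}{2}$. The symmetric part $L^s$ of $L$ is given by the same formula with $p$ replaced by $a$. The $d\times d$ matrix $S$ is defined by $S_{ij}=\frac12\sum_z p(z)z_iz_j$; its invertibility is an equivalent formulation of the assumption that $\{x:a(x)>0\}$ generates $\mathbb{Z}^d$. Measures: for $0\le\theta\le1$, $\mu_\theta$ is the Bernoulli product measure of parameter $\theta$ on $\mathbb{X}$, which is invariant under the dynamics; $\langle\cdot\rangle_\theta$ is expectation under $\mu_\theta$, and $\langle\cdot,\cdot\rangle_\rho$ is the inner product of $L^2(\mu_\rho)$. Space $\mathcal{G}_\rho$: the local functions $g$ with $\langle g\rangle_\rho=0$ and $\frac{d}{d\theta}\langle g\rangle_\theta\big|_{\theta=\rho}=0$. $L\mathcal{G}_\rho=\{Lu:u\in\mathcal{G}_\rho\}$. Translations: $\tau_x\xi(z)=\xi(x+z)$ and $\tau_xg(\xi)=g(\tau_x\xi)$. For $f,g\in\mathcal{G}_\rho$ and $1\le i\le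 d$ set $$\langle g,f\rangle_{\rho,0}=\sum_{x\in\mathbb{Z}^d}\langle g,\tau_xf\rangle_\rho,\qquad t_i(g)=\Big\langle g,\sum_{x\in\mathbb{Z}^d} x_i\xi(x)\Big\rangle_\rho=\sum_{x\in\mathbb{Z}^d}x_i\langle g,\xi(x)\rangle_\rho .$$ Hilbert space of fluctuations: with $\chi(\rho)=\rho(1-\rho)$, for $g\in\mathcal{G}_\rho$, $$\langle\langle g\rangle\rangle_\rho=\sup_{\alpha\in\mathbb{R}^d}\Big(2\sum_{i=1}^d\alpha_it_i(g)-\chi(\rho)\,\alpha\cdot S\alpha\Big)+\sup_{f\in\mathcal{G}_\rho}\Big(2\langle g,f\rangle_{\rho,0}-\langle f,(-L^s)f\rangle_{\rho,0}\Big).$$ $\mathcal{H}(\rho)$ is the closure of $\mathcal{G}_\rho$ under $\langle\langle\cdot\rangle\rangle_\rho^{1/2}$. With $\mathcal{H}_0=\{\sum_{i=1}^d\alpha_i(\xi(e_i)-\xi(0)):\alpha\in\mathbb{R}^d\}$, the decomposition $\mathcal{H}(\rho)=\overline{\mathcal{H}_0+L\mathcal{G}_\rho}$ holds (a theorem of Esposito, Marra and Yau); this yields the existence of the coefficients $D_{ij}$. Currents: for $1\le i\le d$, $$W_i=\frac12\sum_{z\in\mathbb{Z}^d}\Big(p(z)z_i\,\xi(0)(1-\xi(z))-p(-z)z_i\,\xi(z)(1-\xi(0))\Big),$$ and the normalized currents are $$w_i=W_i-\langle W_i\rangle_\rho-(\xi(0)-\rho)\,\frac{d}{d\theta}\langle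 W_i\rangle_\theta\Big|_{\theta=\rho}\in\mathcal{G}_\rho.$$
   Formalization: At ρ=0 and ρ=1 the fluctuation norm vanishes, so every matrix satisfies the defining relation and D is not determined; there D is additionally required to be a limit of diffusion coefficients at densities in (0,1). *)

theory Defs
  imports
    "HOL-Probability.Probability"
    "HOL-Computational_Algebra.Group_Closure"
begin

type_synonym 'n config = "int ^ 'n \<Rightarrow> bool"
type_synonym 'n obs = "'n config \<Rightarrow> real"

definition local_fun :: "('n::finite) obs \<Rightarrow> bool" where
  "local_fun f \<longleftrightarrow>
     (\<exists>A. finite A \<and> (\<forall>\<xi> \<eta>. (\<forall>x\<in>A. \<xi> x = \<eta> x) \<longrightarrow> f \<xi> = f \<eta>))"

definition exchange :: "int ^ 'n \<Rightarrow> int ^ 'n \<Rightarrow> ('n::finite) config \<Rightarrow> 'n config" where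
  "exchange x y \<xi> = \<xi>(x := \<xi> y, y := \<xi> x)"

(* For a local f and a finitely supported rate q only finitely many terms of the sum are nonzero.
   The rate is an arbitrary real function so that q can be both p and its symmetrization. *)
definition sep_generator :: "(int ^ 'n \<Rightarrow> real) \<Rightarrow> ('n::finite) obs \<Rightarrow> 'n obs" where
  "sep_generator q f \<xi> =
     (\<Sum>\<^sub>\<infinity>(x, y)\<in>UNIV.
        q (y - x) * of_bool (\<xi> x) * (1 - of_bool (\<xi> y)) * (f (exchange x y \<xi>) - f \<xi>))"

definition sym_rate :: "(int ^ 'n) pmf \<Rightarrow> int ^ 'n \<Rightarrow> real" where
  "sym_rate p x = (pmf p x + pmf p (- x)) / 2"

definition gen :: "(int ^ ('n::finite)) pmf \<Rightarrow> 'n obs \<Rightarrow> 'n obs" where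
  "gen p = sep_generator (pmf p)"

definition gen_sym :: "(int ^ ('n::finite)) pmf \<Rightarrow> 'n obs \<Rightarrow> 'n obs" where
  "gen_sym p = sep_generator (sym_rate p)"

definition S_matrix :: "(int ^ ('n::finite)) pmf \<Rightarrow> real ^ 'n ^ 'n" where
  "S_matrix p = (\<chi> i j. (\<Sum>\<^sub>\<infinity>z. pmf p z * of_int (z $ i) * of_int (z $ j)) / 2)"

definition bernoulli_measure :: "real \<Rightarrow> ('n::finite) config measure" where
  "bernoulli_measure \<theta> = (\<Pi>\<^sub>M x\<in>UNIV. measure_pmf (bernoulli_pmf \<theta>))"

definition mean :: "real \<Rightarrow> ('n::finite) obs \<Rightarrow> real" where
  "mean \<theta> f = integral\<^sup>L (bernoulli_measure \<theta>) f"

definition L2_prod :: "real \<Rightarrow> ('n::finite) obs \<Rightarrow> 'n obs \<Rightarrow> real" where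
  "L2_prod \<rho> g f = mean \<rho> (\<lambda>\<xi>. g \<xi> * f \<xi>)"

(* The Bernoulli parameter ranges over [0,1], so derivatives in it are taken within this interval
   (one-sided at the endpoints). *)
definition G_space :: "real \<Rightarrow> ('n::finite) obs set" where
  "G_space \<rho> = {g. local_fun g \<and> mean \<rho> g = 0 \<and>
     ((\<lambda>\<theta>. mean \<theta> g) has_real_derivative 0) (at \<rho> within {0..1})}"

definition translate :: "int ^ 'n \<Rightarrow> ('n::finite) obs \<Rightarrow> 'n obs" where
  "translate x g \<xi> = g (\<lambda>z. \<xi> (x + z))"

definition prod0 :: "real \<Rightarrow> ('n::finite) obs \<Rightarrow> 'n obs \<Rightarrow> real" where
  "prod0 \<rho> g f = (\<Sum>\<^sub>\<infinity>x. L2_prod \<rho> g (translate x f))"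

definition t_coeff :: "real \<Rightarrow> ('n::finite) obs \<Rightarrow> real ^ 'n" where
  "t_coeff \<rho> g = (\<chi> i. \<Sum>\<^sub>\<infinity>x. of_int (x $ i) * L2_prod \<rho> g (\<lambda>\<xi>. of_bool (\<xi> x)))"

definition compressibility :: "real \<Rightarrow> real" where
  "compressibility \<rho> = \<rho> * (1 - \<rho>)"

(* Extended-valued, since finiteness of the second supremum is not automatic.
   Both suprema are nonnegative (take alpha = 0 and f = 0). *)
definition fluct_sq :: "(int ^ ('n::finite)) pmf \<Rightarrow> real \<Rightarrow> 'n obs \<Rightarrow> ereal" where
  "fluct_sq p \<rho> g =
     (SUP \<alpha>. ereal (2 * (\<Sum>i\<in>UNIV. \<alpha> $ i * t_coeff \<rho> g $ i)
                    - compressibility \<rho> * (\<alpha> \<bullet> (S_matrix p *v \<alpha>)))) +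
     (SUP f\<in>G_space \<rho>. ereal (2 * prod0 \<rho> g f - prod0 \<rho> f (\<lambda>\<xi>. - gen_sym p f \<xi>)))"

definition fluct_norm :: "(int ^ ('n::finite)) pmf \<Rightarrow> real \<Rightarrow> 'n obs \<Rightarrow> ereal" where
  "fluct_norm p \<rho> g =
     (if fluct_sq p \<rho> g = \<infinity> then \<infinity> else ereal (sqrt (real_of_ereal (fluct_sq p \<rho> g))))"

(* The Hilbert space of fluctuations is the completion of the seminormed space G_space:
   Cauchy sequences modulo sequences tending to 0. *)
definition fluct_Cauchy :: "(int ^ ('n::finite)) pmf \<Rightarrow> real \<Rightarrow> (nat \<Rightarrow> 'n obs) set" where
  "fluct_Cauchy p \<rho> = {u. (\<forall>n. u n \<in> G_space \<rho>) \<and>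
     (\<forall>\<epsilon>::real. \<epsilon> > 0 \<longrightarrow>
        (\<exists>N. \<forall>m\<ge>N. \<forall>n\<ge>N. fluct_norm p \<rho> (\<lambda>\<xi>. u m \<xi> - u n \<xi>) < ereal \<epsilon>))}"

definition fluct_rel ::
    "(int ^ ('n::finite)) pmf \<Rightarrow> real \<Rightarrow> ((nat \<Rightarrow> 'n obs) \<times> (nat \<Rightarrow> 'n obs)) set" where
  "fluct_rel p \<rho> = {(u, v). u \<in> fluct_Cauchy p \<rho> \<and> v \<in> fluct_Cauchy p \<rho> \<and>
     (\<lambda>n. fluct_norm p \<rho> (\<lambda>\<xi>. u n \<xi> - v n \<xi>)) \<longlonglongrightarrow> 0}"

definition H_space :: "(int ^ ('n::finite)) pmf \<Rightarrow> real \<Rightarrow> (nat \<Rightarrow> 'n obs) set set" where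
  "H_space p \<rho> = fluct_Cauchy p \<rho> // fluct_rel p \<rho>"

definition H_embed :: "(int ^ ('n::finite)) pmf \<Rightarrow> real \<Rightarrow> 'n obs \<Rightarrow> (nat \<Rightarrow> 'n obs) set" where
  "H_embed p \<rho> g = fluct_rel p \<rho> `` {\<lambda>_. g}"

(* The limsup is a limit and does not depend on the representatives u and v. *)
definition H_dist ::
    "(int ^ ('n::finite)) pmf \<Rightarrow> real \<Rightarrow> (nat \<Rightarrow> 'n obs) set \<Rightarrow> (nat \<Rightarrow> 'n obs) set \<Rightarrow> ereal" where
  "H_dist p \<rho> U V =
     (INF (u, v)\<in>U \<times> V. limsup (\<lambda>n. fluct_norm p \<rho> (\<lambda>\<xi>. u n \<xi> - v n \<xi>)))"

definition H_closure ::
    "(int ^ ('n::finite)) pmf \<Rightarrow> real \<Rightarrow> (nat \<Rightarrow> 'n obs) set set \<Rightarrow> (nat \<Rightarrow> 'n obs) set set" where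
  "H_closure p \<rho> A =
     {U \<in> H_space p \<rho>. \<forall>\<epsilon>::real. \<epsilon> > 0 \<longrightarrow> (\<exists>V\<in>A. H_dist p \<rho> U V < ereal \<epsilon>)}"

definition current :: "(int ^ ('n::finite)) pmf \<Rightarrow> 'n \<Rightarrow> 'n obs" where
  "current p i \<xi> =
     (\<Sum>\<^sub>\<infinity>z. pmf p z * of_int (z $ i) * of_bool (\<xi> 0) * (1 - of_bool (\<xi> z))
         - pmf p (- z) * of_int (z $ i) * of_bool (\<xi> z) * (1 - of_bool (\<xi> 0))) / 2"

definition norm_current :: "(int ^ ('n::finite)) pmf \<Rightarrow> real \<Rightarrow> 'n \<Rightarrow> 'n obs" where
  "norm_current p \<rho> i \<xi> =
     current p i \<xi> - mean \<rho> (current p i)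
     - (of_bool (\<xi> 0) - \<rho>) *
       vector_derivative (\<lambda>\<theta>. mean \<theta> (current p i)) (at \<rho> within {0..1})"

definition fluct_decomposition ::
    "(int ^ ('n::finite)) pmf \<Rightarrow> real \<Rightarrow> real ^ 'n ^ 'n \<Rightarrow> bool" where
  "fluct_decomposition p \<rho> D \<longleftrightarrow>
     (\<forall>i. H_embed p \<rho> (\<lambda>\<xi>. norm_current p \<rho> i \<xi> -
            (\<Sum>j\<in>UNIV. D $ i $ j * (of_bool (\<xi> 0) - of_bool (\<xi> (axis j 1)))))
          \<in> H_closure p \<rho> (H_embed p \<rho> ` (gen p ` G_space \<rho>)))"

(* For 0 < rho < 1 this is just fluct_decomposition. At rho = 0 and rho = 1 the measure is a point
   mass, the norm of fluctuations vanishes identically and every matrix satisfies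
   fluct_decomposition; there the coefficient is the limit of its values at interior densities. *)
definition diffusion_coefficient ::
    "(int ^ ('n::finite)) pmf \<Rightarrow> real \<Rightarrow> real ^ 'n ^ 'n \<Rightarrow> bool" where
  "diffusion_coefficient p \<rho> D \<longleftrightarrow>
     fluct_decomposition p \<rho> D \<and>
     (\<rho> \<in> {0, 1} \<longrightarrow>
        (\<exists>E. (\<forall>\<theta>. 0 < \<theta> \<and> \<theta> < 1 \<longrightarrow> fluct_decomposition p \<theta> (E \<theta>)) \<and>
             (E \<longlongrightarrow> D) (at \<rho> within {0<..<1})))"

end

theory Submission
  imports Defs
begin

text \<open>Write \<open>R\<close> for the reflection \<open>\<xi>(x) \<mapsto> \<xi>(- x)\<close>. It conjugates \<open>L\<close> to its adjoint under
  \<open>\<langle>\<cdot>,\<cdot>\<rangle>\<^sub>0\<close>, and modulo gradients and translations the currents are combinations of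
  \<open>\<xi>(0) \<xi>(z)\<close>, hence invariant under \<open>R\<close>. If \<open>w\<^sub>i - \<Sum>\<^sub>j D\<^sub>i\<^sub>j (\<xi>(0) - \<xi>(e\<^sub>j)) - L u\<^sub>i\<close> is small,
  then its first moments \<open>t\<^sub>k\<close> give \<open>\<chi> (D\<^sub>i\<^sub>k - S\<^sub>i\<^sub>k) \<approx> - \<langle>w\<^sub>k, u\<^sub>i\<rangle>\<^sub>0\<close>, while
  \<open>\<langle>w\<^sub>k, u\<^sub>i\<rangle>\<^sub>0 = \<langle>w\<^sub>k, R u\<^sub>i\<rangle>\<^sub>0 \<approx> \<langle>L u\<^sub>k, R u\<^sub>i\<rangle>\<^sub>0 = \<langle>L u\<^sub>i, R u\<^sub>k\<rangle>\<^sub>0\<close> is symmetric in \<open>i\<close> and \<open>k\<close>.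
  The errors are controlled by the Dirichlet form of the \<open>u\<^sub>i\<close>. It stays bounded along an
  approximating sequence because \<open>\<langle>v, - L v\<rangle>\<^sub>0\<close> is the Dirichlet form of \<open>v\<close>, which is applied to
  differences of approximants. At \<open>\<rho> = 0\<close> and \<open>\<rho> = 1\<close> symmetry passes to the limit.\<close>

section \<open>Local functions\<close>

text \<open>An explicit support, not necessarily the smallest one: unlike \<open>local_fun\<close>
  it can serve as an index set and be compared with other supports.\<close>

definition depends_on :: "(int ^ 'n) set \<Rightarrow> ('n::finite) obs \<Rightarrow> bool" where
  "depends_on A f \<longleftrightarrow> (\<forall>\<xi> \<eta>. (\<forall>x\<in>A. \<xi> x = \<eta> x) \<longrightarrow> f \<xi> = f \<eta>)"

text \<open>For finite \<open>B\<close> this is the monomial given by the product of \<xi>(x) over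
  \<open>B\<close>.\<close>

definition occupied :: "(int ^ 'n) set \<Rightarrow> ('n::finite) obs" where
  "occupied B \<xi> = of_bool (\<forall>x\<in>B. \<xi> x)"

lemma local_fun_iff: "local_fun f \<longleftrightarrow> (\<exists>A. finite A \<and> depends_on A f)"
  unfolding local_fun_def depends_on_def by blast

lemma depends_on_mono: "depends_on A f \<Longrightarrow> A \<subseteq> B \<Longrightarrow> depends_on B f"
  unfolding depends_on_def by blast

lemma depends_on_binop:
  "depends_on A f \<Longrightarrow> depends_on A g \<Longrightarrow> depends_on A (\<lambda>\<xi>. h (f \<xi>) (g \<xi>))"
  unfolding depends_on_def by (intro allI impI arg_cong2[of _ _ _ _ h]) simp_all

lemma depends_on_permute: "depends_on A f \<Longrightarrow> depends_on (\<sigma> ` A) (\<lambda>\<xi>. f (\<xi> \<circ> \<sigma>))"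
  unfolding depends_on_def by simp

lemma depends_on_occupied: "depends_on B (occupied B)"
  unfolding depends_on_def occupied_def by (intro allI impI arg_cong[of _ _ of_bool]) simp

lemma occupied_empty [simp]: "occupied {} = (\<lambda>\<xi>. 1)"
  by (auto simp: occupied_def)

lemma occupied_mult: "occupied A \<xi> * occupied B \<xi> = occupied (A \<union> B) \<xi>"
  by (auto simp: occupied_def)

lemma occupied_single: "occupied {x} \<xi> = of_bool (\<xi> x)"
  by (simp add: occupied_def)

lemma occupied_permute: "occupied B (\<xi> \<circ> \<sigma>) = occupied (\<sigma> ` B) \<xi>"
  by (simp add: occupied_def)

lemma local_fun_binop:
  assumes "local_fun f" "local_fun g"
  shows "local_fun (\<lambda>\<xi>. h (f \<xi>) (g \<xi>))"
proof -
  obtain A B where "finite A" "depends_on A f" "finite B" "depends_on B g"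
    using assms unfolding local_fun_iff by blast
  then have "depends_on (A \<union> B) f" "depends_on (A \<union> B) g" "finite (A \<union> B)"
    by (auto intro: depends_on_mono)
  then show ?thesis
    unfolding local_fun_iff using depends_on_binop[of "A \<union> B" f g h] by blast
qed

lemma local_fun_const [intro, simp]: "local_fun (\<lambda>_. c)"
  unfolding local_fun_def by blast

lemma local_fun_occupied [intro, simp]: "finite B \<Longrightarrow> local_fun (occupied B)"
  unfolding local_fun_iff by (intro exI[of _ B] conjI depends_on_occupied)

lemma local_fun_site [intro, simp]: "local_fun (\<lambda>\<xi>. of_bool (\<xi> x))"
  using local_fun_occupied[of "{x}"] by (simp add: occupied_def[abs_def])

lemmas local_fun_add [intro] = local_fun_binop[where h = "(+)"]
lemmas local_fun_diff [intro] = local_fun_binop[where h = "(-)"]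
lemmas local_fun_mult [intro] = local_fun_binop[where h = "(*)"]

lemma local_fun_sum [intro]: "(\<And>i. i \<in> I \<Longrightarrow> local_fun (f i)) \<Longrightarrow> local_fun (\<lambda>\<xi>. \<Sum>i\<in>I. f i \<xi>)"
  by (induction I rule: infinite_finite_induct) auto

lemma local_fun_permute: "local_fun f \<Longrightarrow> local_fun (\<lambda>\<xi>. f (\<xi> \<circ> \<sigma>))"
  unfolding local_fun_iff using depends_on_permute[of _ f \<sigma>] finite_imageI[of _ \<sigma>] by blast

text \<open>Splitting off one coordinate at a time, a local function is a polynomial in the occupation
  variables; this reduces every identity below that is linear in local functions to monomials.\<close>

lemma depends_on_induct [consumes 2, case_names monomial linear]:
  assumes "finite A" and "depends_on A f"
    and "\<And>B. B \<subseteq> A \<Longrightarrow> P (occupied B)"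
    and "\<And>f g c. P f \<Longrightarrow> P g \<Longrightarrow> P (\<lambda>\<xi>. f \<xi> + c * g \<xi>)"
  shows "P f"
  using assms
proof (induction A arbitrary: f P rule: finite_induct)
  case empty
  then have "f = (\<lambda>\<xi>. f undefined)"
    unfolding depends_on_def by (intro ext) simp
  \<comment> \<open>\<open>P\<close> is only closed under \<open>f + c * g\<close>, so a constant
    \<open>c\<close> is written as \<open>1 + (c - 1) * 1\<close>.\<close>
  moreover have "P (\<lambda>\<xi>. occupied {} \<xi> + (f undefined - 1) * occupied {} \<xi>)"
    by (rule empty.prems(3)[OF empty.prems(2) empty.prems(2)]) auto
  ultimately show ?case
    by simp
next
  case (insert a A)
  \<comment> \<open>The decomposition is \<open>f = f0 + \<xi>(a) (f1 - f0)\<close>, where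
    \<open>f0\<close> and \<open>f1\<close> no longer see the coordinate \<open>a\<close>.\<close>
  define f0 f1 where "f0 = (\<lambda>\<xi>. f (\<xi>(a := False)))" and "f1 = (\<lambda>\<xi>. f (\<xi>(a := True)))"
  have dep: "depends_on A f0" "depends_on A f1"
    using insert.prems(1) unfolding f0_def f1_def depends_on_def by auto
  have "P f0"
  proof (rule insert.IH[of f0 P])
    show "P (occupied B)" if "B \<subseteq> A" for B
      using that by (intro insert.prems(2)) auto
  qed (rule dep(1), rule insert.prems(3))
  \<comment> \<open>Here the induction hypothesis is used for the predicate that multiplies by
    \<open>occupied {a}\<close> before applying \<open>P\<close>; hence the generalization over
    \<open>P\<close>.\<close>
  moreover have "P (\<lambda>\<xi>. occupied {a} \<xi> * (f1 \<xi> - f0 \<xi>))"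
  proof (rule insert.IH[of "\<lambda>\<xi>. f1 \<xi> - f0 \<xi>" "\<lambda>g. P (\<lambda>\<xi>. occupied {a} \<xi> * g \<xi>)"])
    show "depends_on A (\<lambda>\<xi>. f1 \<xi> - f0 \<xi>)"
      by (rule depends_on_binop[OF dep(2,1), of "(-)"])
  next
    fix B assume "B \<subseteq> A"
    then show "P (\<lambda>\<xi>. occupied {a} \<xi> * occupied B \<xi>)"
      unfolding occupied_mult by (intro insert.prems(2)) auto
  next
    fix g h c
    assume "P (\<lambda>\<xi>. occupied {a} \<xi> * g \<xi>)" "P (\<lambda>\<xi>. occupied {a} \<xi> * h \<xi>)"
    from insert.prems(3)[OF this, of c]
    show "P (\<lambda>\<xi>. occupied {a} \<xi> * (g \<xi> + c * h \<xi>))"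
      by (simp add: algebra_simps)
  qed
  ultimately have "P (\<lambda>\<xi>. f0 \<xi> + 1 * (occupied {a} \<xi> * (f1 \<xi> - f0 \<xi>)))"
    by (rule insert.prems(3))
  moreover have "f \<xi> = f0 \<xi> + 1 * (occupied {a} \<xi> * (f1 \<xi> - f0 \<xi>))" for \<xi>
    by (cases "\<xi> a") (auto simp: f0_def f1_def occupied_def fun_upd_idem)
  ultimately show ?case
    by simp
qed

lemma local_fun_induct [consumes 1, case_names monomial linear]:
  assumes "local_fun f"
    and "\<And>B. finite B \<Longrightarrow> P (occupied B)"
    and "\<And>f g c. P f \<Longrightarrow> P g \<Longrightarrow> P (\<lambda>\<xi>. f \<xi> + c * g \<xi>)"
  shows "P f"
proof -
  obtain A where "finite A" "depends_on A f"
    using assms(1) local_fun_iff by blast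
  then show ?thesis
  proof (rule depends_on_induct[where P = P])
    show "P (occupied B)" if "B \<subseteq> A" for B
      using assms(2) finite_subset[OF that \<open>finite A\<close>] .
  qed (rule assms(3))
qed

section \<open>The Bernoulli measure on local functions\<close>

lemma prob_space_bernoulli_measure: "prob_space (bernoulli_measure \<theta>)"
  unfolding bernoulli_measure_def by (intro prob_space_PiM measure_pmf.prob_space_axioms)

text \<open>The monomial is the indicator of a cylinder set, whose product measure factorizes. The
  factor stays \<open>pmf (bernoulli_pmf \<theta>) True\<close> because it equals \<theta> only for
  \<theta> in [0,1].\<close>

lemma occupied_integral:
  fixes B :: "(int ^ 'n::finite) set"
  assumes "finite B"
  shows "integrable (bernoulli_measure \<theta>) (occupied B)"
    and "mean \<theta> (occupied B) = pmf (bernoulli_pmf \<theta>) True ^ card B"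
proof -
  interpret M: prob_space "bernoulli_measure \<theta> :: 'n config measure"
    by (rule prob_space_bernoulli_measure)
  interpret P: product_prob_space "\<lambda>_. measure_pmf (bernoulli_pmf \<theta>)" "UNIV :: (int ^ 'n) set"
    by unfold_locales
  define E where "E = prod_emb UNIV (\<lambda>_. measure_pmf (bernoulli_pmf \<theta>)) B (\<Pi>\<^sub>E x\<in>B. {True})"
  have E: "E \<in> sets (bernoulli_measure \<theta>)"
    unfolding E_def bernoulli_measure_def using assms by (intro sets_PiM_I) auto
  have ind: "occupied B = (indicator E :: 'n config \<Rightarrow> real)"
    by (auto simp: fun_eq_iff occupied_def E_def prod_emb_def space_PiM PiE_iff extensional_def
        split: split_indicator)
  have "measure (bernoulli_measure \<theta>) E
      = (\<Prod>x\<in>B. measure (measure_pmf (bernoulli_pmf \<theta>)) {True})"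
    unfolding E_def bernoulli_measure_def using assms by (intro P.measure_PiM_emb) auto
  then have "measure (bernoulli_measure \<theta>) E = pmf (bernoulli_pmf \<theta>) True ^ card B"
    by (simp add: measure_pmf_single)
  then show "mean \<theta> (occupied B) = pmf (bernoulli_pmf \<theta>) True ^ card B"
    using E unfolding mean_def ind by simp
  show "integrable (bernoulli_measure \<theta>) (occupied B)"
    unfolding ind using E by (intro integrable_real_indicator) (auto simp: M.emeasure_finite less_top[symmetric])
qed

lemma mean_occupied:
  "finite B \<Longrightarrow> 0 \<le> \<theta> \<Longrightarrow> \<theta> \<le> 1 \<Longrightarrow> mean \<theta> (occupied B) = \<theta> ^ card B"
  by (simp add: occupied_integral)

lemma local_fun_integrable: "local_fun f \<Longrightarrow> integrable (bernoulli_measure \<theta>) f"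
  by (induction rule: local_fun_induct) (auto simp: occupied_integral)

lemma mean_const [simp]: "mean \<theta> (\<lambda>_. c) = c"
  by (simp add: mean_def prob_space.prob_space[OF prob_space_bernoulli_measure])

lemma mean_cmult [simp]: "mean \<theta> (\<lambda>\<xi>. c * f \<xi>) = c * mean \<theta> f"
  by (simp add: mean_def)

lemma mean_add: "local_fun f \<Longrightarrow> local_fun g \<Longrightarrow> mean \<theta> (\<lambda>\<xi>. f \<xi> + g \<xi>) = mean \<theta> f + mean \<theta> g"
  by (simp add: mean_def local_fun_integrable)

lemma mean_diff: "local_fun f \<Longrightarrow> local_fun g \<Longrightarrow> mean \<theta> (\<lambda>\<xi>. f \<xi> - g \<xi>) = mean \<theta> f - mean \<theta> g"
  by (simp add: mean_def local_fun_integrable)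

lemma mean_sum: "(\<And>i. i \<in> I \<Longrightarrow> local_fun (f i)) \<Longrightarrow> mean \<theta> (\<lambda>\<xi>. \<Sum>i\<in>I. f i \<xi>) = (\<Sum>i\<in>I. mean \<theta> (f i))"
  by (simp add: mean_def local_fun_integrable)

lemma mean_permute:
  assumes "local_fun f" "inj \<sigma>"
  shows "mean \<theta> (\<lambda>\<xi>. f (\<xi> \<circ> \<sigma>)) = mean \<theta> f"
proof -
  \<comment> \<open>Locality is carried through the induction because additivity of the mean
    requires it.\<close>
  have "local_fun f \<and> mean \<theta> (\<lambda>\<xi>. f (\<xi> \<circ> \<sigma>)) = mean \<theta> f"
    using assms(1)
  proof (induction rule: local_fun_induct)
    case (monomial B)
    then show ?case
      unfolding occupied_permute using assms(2)
      by (simp add: occupied_integral card_image inj_on_subset)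
  next
    case (linear f g c)
    then show ?case
      using local_fun_permute[of f \<sigma>] local_fun_permute[of g \<sigma>]
      by (simp add: mean_add local_fun_add local_fun_mult comp_def)
  qed
  then show ?thesis ..
qed

text \<open>Independence of disjoint blocks. For two monomials it is additivity of
  \<open>card\<close> on disjoint sets; one induction extends this in \<open>f\<close>, a second one
  in \<open>g\<close>.\<close>

lemma mean_mult_disjoint:
  assumes "finite A" "depends_on A f" "finite C" "depends_on C g" "A \<inter> C = {}"
  shows "mean \<theta> (\<lambda>\<xi>. f \<xi> * g \<xi>) = mean \<theta> f * mean \<theta> g"
proof -
  have *: "local_fun f \<and> mean \<theta> (\<lambda>\<xi>. f \<xi> * occupied B \<xi>) = mean \<theta> f * mean \<theta> (occupied B)"
    if "B \<subseteq> C" for B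
    using assms(1,2)
  proof (induction rule: depends_on_induct)
    case (monomial D)
    then have "finite B" "finite D" "D \<inter> B = {}"
      using that assms finite_subset by blast+
    then show ?case
      by (simp add: occupied_mult occupied_integral card_Un_disjoint power_add)
  next
    case (linear f g c)
    have "finite B"
      using that assms(3) finite_subset by blast
    then show ?case
      using linear by (auto simp: mean_add local_fun_add local_fun_mult distrib_right mult.assoc)
  qed
  have f: "local_fun f"
    using * by blast
  have "local_fun g \<and> mean \<theta> (\<lambda>\<xi>. f \<xi> * g \<xi>) = mean \<theta> f * mean \<theta> g"
    using assms(3,4)
  proof (induction rule: depends_on_induct)
    case (monomial D)
    then show ?case
      using * assms(3) finite_subset by blast
  next
    case (linear g h c)
    then have "mean \<theta> (\<lambda>\<xi>. f \<xi> * (g \<xi> + c * h \<xi>)) = mean \<theta> (\<lambda>\<xi>. f \<xi> * g \<xi> + c * (f \<xi> * h \<xi>))"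
      by (simp add: algebra_simps)
    then show ?case
      using linear f by (auto simp: mean_add local_fun_add local_fun_mult distrib_left)
  qed
  then show ?thesis ..
qed

text \<open>Multiplication by \<xi>(x) inserts \<open>x\<close> into \<open>B\<close>. This changes
  nothing if \<open>x\<close> is already there and costs a factor \<rho> otherwise.\<close>

lemma mean_occupied_site:
  assumes "finite B" "0 \<le> \<rho>" "\<rho> \<le> 1"
  shows "mean \<rho> (\<lambda>\<xi>. occupied B \<xi> * (of_bool (\<xi> x) - \<rho>)) = of_bool (x \<in> B) * (\<rho> ^ card B * (1 - \<rho>))"
proof -
  have "mean \<rho> (\<lambda>\<xi>. occupied B \<xi> * (of_bool (\<xi> x) - \<rho>))
      = mean \<rho> (\<lambda>\<xi>. occupied (insert x B) \<xi> - \<rho> * occupied B \<xi>)"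
    by (simp add: right_diff_distrib occupied_mult mult.commute flip: occupied_single)
  also have "\<dots> = mean \<rho> (occupied (insert x B)) - \<rho> * mean \<rho> (occupied B)"
    using assms by (subst mean_diff) auto
  also have "\<dots> = of_bool (x \<in> B) * (\<rho> ^ card B * (1 - \<rho>))"
    using assms by (auto simp: mean_occupied card_insert_if insert_absorb algebra_simps)
  finally show ?thesis .
qed

text \<open>Differentiating \<open>\<rho> ^ card B\<close> amounts to summing covariances with the occupation variables.\<close>

lemma mean_has_derivative:
  assumes "finite A" "depends_on A f" and \<rho>: "0 < \<rho>" "\<rho> < 1"
  shows "((\<lambda>\<theta>. mean \<theta> f) has_real_derivative
    (\<Sum>x\<in>A. mean \<rho> (\<lambda>\<xi>. f \<xi> * (of_bool (\<xi> x) - \<rho>))) / (\<rho> * (1 - \<rho>))) (at \<rho> within {0..1})"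
proof -
  define c where "c = (\<lambda>f. \<Sum>x\<in>A. mean \<rho> (\<lambda>\<xi>. f \<xi> * (of_bool (\<xi> x) - \<rho>)))"
  have "local_fun f \<and>
    ((\<lambda>\<theta>. mean \<theta> f) has_real_derivative c f / (\<rho> * (1 - \<rho>))) (at \<rho> within {0..1})"
    using assms(1,2)
  proof (induction rule: depends_on_induct)
    case (monomial B)
    have B: "finite B"
      using monomial assms(1) finite_subset by blast
    have m: "mean \<rho> (\<lambda>\<xi>. occupied B \<xi> * (of_bool (\<xi> x) - \<rho>)) = of_bool (x \<in> B) * (\<rho> ^ card B * (1 - \<rho>))"
      for x
      using B \<rho> by (intro mean_occupied_site) auto
    have "c (occupied B) = card B * (\<rho> ^ card B * (1 - \<rho>))"
      using monomial assms(1) unfolding c_def m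
      by (simp add: sum_distrib_right[symmetric] Int_absorb1 of_bool_def sum.If_cases)
    \<comment> \<open>For empty \<open>B\<close> the truncated exponent \<open>card B - 1\<close>
      does no harm, since the factor \<open>card B\<close> vanishes.\<close>
    then have c: "c (occupied B) / (\<rho> * (1 - \<rho>)) = card B * \<rho> ^ (card B - 1)"
      using \<rho> by (cases "card B") (auto simp: field_simps)
    have "((\<lambda>\<theta>. \<theta> ^ card B) has_real_derivative card B * \<rho> ^ (card B - 1)) (at \<rho> within {0..1})"
      by (auto intro!: derivative_eq_intros)
    \<comment> \<open>The mean is known to be a power of \<theta> only on [0,1], which is enough for
      a derivative within that interval.\<close>
    then have "((\<lambda>\<theta>. mean \<theta> (occupied B)) has_real_derivative card B * \<rho> ^ (card B - 1))
        (at \<rho> within {0..1})"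
      by (rule has_field_derivative_transform_within[OF _ zero_less_one])
        (use \<rho> B in \<open>auto simp: mean_occupied\<close>)
    then show ?case
      using B c by simp
  next
    case (linear f g a)
    have "c (\<lambda>\<xi>. f \<xi> + a * g \<xi>) = c f + a * c g"
      using linear unfolding c_def 
      by (simp add: distrib_right mean_add local_fun_mult local_fun_diff sum.distrib mult.assoc
          flip: sum_distrib_left)
    moreover have "((\<lambda>\<theta>. mean \<theta> f + a * mean \<theta> g) has_real_derivative
        c f / (\<rho> * (1 - \<rho>)) + a * (c g / (\<rho> * (1 - \<rho>)))) (at \<rho> within {0..1})"
      using linear by (intro DERIV_add DERIV_cmult) auto
    ultimately show ?case
      using linear by (auto simp: mean_add local_fun_add local_fun_mult add_divide_distrib)
  qed
  then show ?thesis
    unfolding c_def ..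
qed


section \<open>Translations and reflection\<close>

definition reflect :: "('n::finite) obs \<Rightarrow> 'n obs" where
  "reflect g \<xi> = g (\<lambda>z. \<xi> (- z))"

lemma translate_comp: "translate x g = (\<lambda>\<xi>. g (\<xi> \<circ> (+) x))"
  by (simp add: translate_def comp_def fun_eq_iff)

lemma reflect_comp: "reflect g = (\<lambda>\<xi>. g (\<xi> \<circ> uminus))"
  by (simp add: reflect_def comp_def fun_eq_iff)

lemma exchange_comp: "exchange x y \<xi> = \<xi> \<circ> id(x := y, y := x)"
  by (auto simp: exchange_def fun_eq_iff)

lemma exchange_involution [simp]: "exchange x y (exchange x y \<xi>) = \<xi>"
  by (auto simp: exchange_def fun_eq_iff)

lemma exchange_commute: "exchange x y = exchange y x"
  by (auto simp: exchange_def fun_eq_iff)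

lemma local_fun_translate [intro, simp]: "local_fun f \<Longrightarrow> local_fun (translate x f)"
  unfolding translate_comp by (rule local_fun_permute)

lemma local_fun_reflect [intro, simp]: "local_fun f \<Longrightarrow> local_fun (reflect f)"
  unfolding reflect_comp by (rule local_fun_permute)

lemma local_fun_exchange: "local_fun f \<Longrightarrow> local_fun (\<lambda>\<xi>. f (exchange x y \<xi>))"
  unfolding exchange_comp by (rule local_fun_permute)

lemma mean_translate [simp]: "local_fun f \<Longrightarrow> mean \<theta> (translate x f) = mean \<theta> f"
  unfolding translate_comp by (rule mean_permute) auto

lemma mean_reflect [simp]: "local_fun f \<Longrightarrow> mean \<theta> (reflect f) = mean \<theta> f"
  unfolding reflect_comp by (rule mean_permute) auto

lemma mean_exchange: "local_fun f \<Longrightarrow> mean \<theta> (\<lambda>\<xi>. f (exchange x y \<xi>)) = mean \<theta> f"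
  unfolding exchange_comp by (rule mean_permute) (auto simp: inj_def)

lemma translate_zero [simp]: "translate 0 f = f"
  by (simp add: translate_def fun_eq_iff)

lemma translate_translate [simp]: "translate x (translate y f) = translate (x + y) f"
  by (simp add: translate_def fun_eq_iff add.assoc)

lemma reflect_reflect [simp]: "reflect (reflect f) = f"
  by (simp add: reflect_def fun_eq_iff)

lemma translate_reflect: "translate x (reflect f) = reflect (translate (- x) f)"
  by (simp add: translate_def reflect_def fun_eq_iff)

lemma translate_linear:
  "translate x (\<lambda>\<xi>. g \<xi> + c * h \<xi>) = (\<lambda>\<xi>. translate x g \<xi> + c * translate x h \<xi>)"
  by (simp add: translate_def fun_eq_iff)

section \<open>The inner product and its sum over translates\<close>

lemma L2_prod_commute: "L2_prod \<theta> f g = L2_prod \<theta> g f"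
  by (simp add: L2_prod_def mult.commute)

lemma L2_prod_translate:
  assumes "local_fun f" "local_fun g"
  shows "L2_prod \<theta> (translate x f) (translate x g) = L2_prod \<theta> f g"
  using mean_translate[OF local_fun_mult[OF assms]] by (simp add: L2_prod_def translate_def[abs_def])

lemma L2_prod_reflect:
  assumes "local_fun f" "local_fun g"
  shows "L2_prod \<theta> (reflect f) (reflect g) = L2_prod \<theta> f g"
  using mean_reflect[OF local_fun_mult[OF assms]] by (simp add: L2_prod_def reflect_def[abs_def])

lemma L2_prod_linear_left:
  assumes "local_fun f" "local_fun g" "local_fun h"
  shows "L2_prod \<theta> (\<lambda>\<xi>. f \<xi> + c * g \<xi>) h = L2_prod \<theta> f h + c * L2_prod \<theta> g h"
proof -
  have "mean \<theta> (\<lambda>\<xi>. f \<xi> * h \<xi> + c * (g \<xi> * h \<xi>))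
      = mean \<theta> (\<lambda>\<xi>. f \<xi> * h \<xi>) + c * mean \<theta> (\<lambda>\<xi>. g \<xi> * h \<xi>)"
    using assms by (subst mean_add) (auto intro!: local_fun_mult)
  then show ?thesis
    by (simp add: L2_prod_def algebra_simps)
qed

text \<open>A translate of \<open>f\<close> whose support misses that of \<open>g\<close> is
  independent of \<open>g\<close>, so only differences of points of the two supports remain.\<close>

lemma finite_correlated_translates:
  assumes "local_fun f" "local_fun g"
  shows "finite {x. L2_prod \<theta> g (translate x f) \<noteq> mean \<theta> g * mean \<theta> f}"
proof -
  obtain A where A: "finite A" "depends_on A f"
    using assms(1) local_fun_iff by blast
  obtain B where B: "finite B" "depends_on B g"
    using assms(2) local_fun_iff by blast
  have "{x. L2_prod \<theta> g (translate x f) \<noteq> mean \<theta> g * mean \<theta> f} \<subseteq> (\<lambda>(a, b). b - a) ` (A \<times> B)"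
  proof
    fix x assume x: "x \<in> {x. L2_prod \<theta> g (translate x f) \<noteq> mean \<theta> g * mean \<theta> f}"
    have d: "depends_on ((+) x ` A) (translate x f)"
      unfolding translate_comp using A(2) by (rule depends_on_permute)
    have "B \<inter> (+) x ` A \<noteq> {}"
    proof
      assume "B \<inter> (+) x ` A = {}"
      from mean_mult_disjoint[OF B finite_imageI[OF A(1)] d this] assms x show False
        by (simp add: L2_prod_def)
    qed
    then show "x \<in> (\<lambda>(a, b). b - a) ` (A \<times> B)"
      by (force simp: image_iff)
  qed
  then show ?thesis
    using A(1) B(1) finite_subset by blast
qed

text \<open>Mean zero of one factor makes all but finitely many terms of the sum in
  \<open>prod0\<close> vanish.\<close>

definition centered :: "real \<Rightarrow> ('n::finite) obs \<Rightarrow> bool" where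
  "centered \<rho> f \<longleftrightarrow> local_fun f \<and> mean \<rho> f = 0"

lemma centered_local [dest]: "centered \<rho> f \<Longrightarrow> local_fun f"
  by (simp add: centered_def)

lemma centered_linear: "centered \<rho> f \<Longrightarrow> centered \<rho> g \<Longrightarrow> centered \<rho> (\<lambda>\<xi>. f \<xi> + c * g \<xi>)"
  by (auto simp: centered_def mean_add local_fun_add local_fun_mult)

lemma centered_reflect: "centered \<rho> f \<Longrightarrow> centered \<rho> (reflect f)"
  by (simp add: centered_def)

lemma summable_prod0:
  assumes "local_fun g" "centered \<rho> f"
  shows "(\<lambda>x. L2_prod \<rho> g (translate x f)) summable_on UNIV"
  using finite_correlated_translates[of f g \<rho>] assms
  by (intro finite_nonzero_values_imp_summable_on) (auto simp: centered_def)

text \<open>Centering is asked of the right factor only, so that the left one can be split into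
  monomials, whose means need not vanish.\<close>

lemma prod0_linear_left:
  assumes "local_fun g" "local_fun h" "centered \<rho> f"
  shows "prod0 \<rho> (\<lambda>\<xi>. g \<xi> + c * h \<xi>) f = prod0 \<rho> g f + c * prod0 \<rho> h f"
  using assms unfolding prod0_def
  by (simp add: L2_prod_linear_left centered_local summable_prod0 infsum_add infsum_cmult_right'
      summable_on_cmult_right)

lemma prod0_const: "mean \<rho> f = 0 \<Longrightarrow> local_fun f \<Longrightarrow> prod0 \<rho> (\<lambda>_. c) f = 0"
  by (simp add: prod0_def L2_prod_def)

lemma prod0_sum_left:
  assumes "finite I" "\<And>i. i \<in> I \<Longrightarrow> local_fun (g i)" "centered \<rho> f"
  shows "prod0 \<rho> (\<lambda>\<xi>. \<Sum>i\<in>I. c i * g i \<xi>) f = (\<Sum>i\<in>I. c i * prod0 \<rho> (g i) f)"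
  using assms
proof (induction I rule: finite_induct)
  case empty
  then show ?case
    by (simp add: prod0_const centered_def)
next
  case (insert i I)
  have "local_fun (\<lambda>\<xi>. \<Sum>i\<in>I. c i * g i \<xi>)"
    using insert.prems by (auto intro!: local_fun_sum local_fun_mult)
  with insert have "prod0 \<rho> (\<lambda>\<xi>. (\<Sum>i\<in>I. c i * g i \<xi>) + c i * g i \<xi>) f
      = (\<Sum>i\<in>I. c i * prod0 \<rho> (g i) f) + c i * prod0 \<rho> (g i) f"
    by (subst prod0_linear_left) auto
  with insert show ?case
    by (simp add: add.commute)
qed

text \<open>By invariance of the measure, translating one factor by \<open>x\<close> amounts to
  translating the other by \<open>- x\<close>; the sum runs over both.\<close>

lemma prod0_commute:
  assumes "local_fun f" "local_fun g"
  shows "prod0 \<rho> g f = prod0 \<rho> f g"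
proof -
  have "L2_prod \<rho> g (translate x f) = L2_prod \<rho> f (translate (- x) g)" for x
    using L2_prod_translate[of "translate (- x) g" f \<rho> x] assms by (simp add: L2_prod_commute)
  then have "prod0 \<rho> g f = (\<Sum>\<^sub>\<infinity>x. L2_prod \<rho> f (translate (- x) g))"
    by (simp add: prod0_def)
  also have "\<dots> = prod0 \<rho> f g"
    unfolding prod0_def by (rule infsum_reindex_bij_betw) (simp add: bij_uminus)
  finally show ?thesis .
qed

lemma prod0_linear_right:
  assumes "centered \<rho> g" "centered \<rho> h" "local_fun f"
  shows "prod0 \<rho> f (\<lambda>\<xi>. g \<xi> + c * h \<xi>) = prod0 \<rho> f g + c * prod0 \<rho> f h"
proof -
  have "L2_prod \<rho> f (translate x (\<lambda>\<xi>. g \<xi> + c * h \<xi>))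
      = L2_prod \<rho> f (translate x g) + c * L2_prod \<rho> f (translate x h)" for x
    using L2_prod_linear_left[of "translate x g" "translate x h" f \<rho> c] assms
    by (simp add: L2_prod_commute[of \<rho> f] translate_linear centered_local)
  then show ?thesis
    using assms unfolding prod0_def
    by (simp add: summable_prod0 infsum_add infsum_cmult_right' summable_on_cmult_right)
qed

text \<open>Summing over all translates forgets positions. This makes gradients invisible to
  \<open>prod0\<close> and lets a pair of sites be moved to the origin.\<close>

lemma prod0_translate_left:
  assumes "local_fun f" "local_fun g"
  shows "prod0 \<rho> (translate y g) f = prod0 \<rho> g f"
proof -
  have "L2_prod \<rho> (translate y g) (translate x f) = L2_prod \<rho> g (translate (x - y) f)" for x
    using L2_prod_translate[of g "translate (x - y) f" \<rho> y] assms by simp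
  then have "prod0 \<rho> (translate y g) f = (\<Sum>\<^sub>\<infinity>x. L2_prod \<rho> g (translate (x - y) f))"
    by (simp add: prod0_def)
  also have "\<dots> = prod0 \<rho> g f"
    unfolding prod0_def by (rule infsum_reindex_bij_betw)
      (auto intro!: bij_betw_byWitness[where f' = "\<lambda>x. x + y"])
  finally show ?thesis .
qed

lemma prod0_reflect:
  assumes "local_fun f" "local_fun g"
  shows "prod0 \<rho> (reflect g) (reflect f) = prod0 \<rho> g f"
proof -
  have "prod0 \<rho> (reflect g) (reflect f) = (\<Sum>\<^sub>\<infinity>x. L2_prod \<rho> g (translate (- x) f))"
    using assms by (simp add: prod0_def translate_reflect L2_prod_reflect)
  also have "\<dots> = prod0 \<rho> g f"
    unfolding prod0_def by (rule infsum_reindex_bij_betw) (simp add: bij_uminus)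
  finally show ?thesis .
qed

section \<open>The generator\<close>

definition allowed :: "int ^ 'n \<Rightarrow> int ^ 'n \<Rightarrow> ('n::finite) obs" where
  "allowed x y \<xi> = of_bool (\<xi> x) * (1 - of_bool (\<xi> y))"

lemma local_fun_allowed [intro, simp]: "local_fun (allowed x y)"
  unfolding allowed_def[abs_def] by (intro local_fun_mult local_fun_diff local_fun_const local_fun_site)

lemma allowed_exchange: "allowed x y (exchange x y \<xi>) = allowed y x \<xi>"
  by (auto simp: allowed_def exchange_def)

text \<open>The starting points \<open>x\<close> for which the jump from \<open>x\<close> to
  \<open>x + z\<close> touches \<open>A\<close>.\<close>

definition jump_sites :: "(int ^ 'n) set \<Rightarrow> int ^ 'n \<Rightarrow> (int ^ 'n::finite) set" where
  "jump_sites A z = A \<union> (\<lambda>a. a - z) ` A"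

lemma finite_jump_sites [simp]: "finite A \<Longrightarrow> finite (jump_sites A z)"
  by (simp add: jump_sites_def)

lemma shift_jump_sites: "(\<lambda>x. x + z) ` jump_sites A z = jump_sites A (- z)"
  by (force simp: jump_sites_def image_Un image_image)

lemma depends_on_exchange:
  "depends_on A f \<Longrightarrow> x \<notin> A \<Longrightarrow> y \<notin> A \<Longrightarrow> f (exchange x y \<xi>) = f \<xi>"
  unfolding depends_on_def exchange_def by (metis fun_upd_other)

text \<open>A jump that misses \<open>A\<close> leaves \<open>f\<close> unchanged; the remaining
  ones are indexed by displacement and starting point. \<open>Z\<close> may exceed the support of
  \<open>q\<close>, so that several rates can share one index set.\<close>

lemma sep_generator_eq_sum:
  assumes "finite A" "depends_on A f" "finite Z" "{z. q z \<noteq> 0} \<subseteq> Z"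
  shows "sep_generator q f \<xi> = (\<Sum>(z, x)\<in>Sigma Z (jump_sites A).
    q z * (allowed x (x + z) \<xi> * (f (exchange x (x + z) \<xi>) - f \<xi>)))"
proof -
  let ?u = "\<lambda>(x, y). q (y - x) * of_bool (\<xi> x) * (1 - of_bool (\<xi> y)) * (f (exchange x y \<xi>) - f \<xi>)"
  let ?e = "\<lambda>(z, x). (x, x + z)"
  let ?T = "?e ` Sigma Z (jump_sites A)"
  have fin: "finite ?T"
    using assms by auto
  have "?u w = 0" if "w \<notin> ?T" for w
  proof -
    obtain x y where w: "w = (x, y)"
      by (cases w)
    have "q (y - x) = 0 \<or> x \<notin> jump_sites A (y - x)"
    proof (rule ccontr)
      assume "\<not> ?thesis"
      then have "(y - x, x) \<in> Sigma Z (jump_sites A)"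
        using assms(4) by auto
      then have "?e (y - x, x) \<in> ?T"
        by (rule imageI)
      then show False
        using that w by simp
    qed
    then have "q (y - x) = 0 \<or> (x \<notin> A \<and> y \<notin> A)"
      by (force simp: jump_sites_def)
    then show ?thesis
      using depends_on_exchange[OF assms(2)] w by auto
  qed
  then have "sep_generator q f \<xi> = (\<Sum>\<^sub>\<infinity>w\<in>?T. ?u w)"
    unfolding sep_generator_def by (intro infsum_cong_neutral) auto
  also have "\<dots> = (\<Sum>w\<in>?T. ?u w)"
    using fin by simp
  also have "\<dots> = (\<Sum>w\<in>Sigma Z (jump_sites A). ?u (?e w))"
    by (subst sum.reindex) (auto simp: inj_on_def comp_def)
  also have "\<dots> = (\<Sum>(z, x)\<in>Sigma Z (jump_sites A).
      q z * (allowed x (x + z) \<xi> * (f (exchange x (x + z) \<xi>) - f \<xi>)))"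
    by (intro sum.cong) (auto simp: allowed_def)
  finally show ?thesis .
qed

lemma local_fun_sep_generator:
  assumes "local_fun f" "finite {z. q z \<noteq> 0}"
  shows "local_fun (sep_generator q f)"
proof -
  obtain A where A: "finite A" "depends_on A f"
    using assms(1) local_fun_iff by blast
  show ?thesis
    unfolding sep_generator_eq_sum[OF A assms(2) subset_refl, abs_def] case_prod_unfold
    by (intro local_fun_sum local_fun_mult local_fun_const local_fun_diff local_fun_allowed
        local_fun_exchange assms(1))
qed

lemma sep_generator_linear:
  assumes "local_fun f" "local_fun g" "finite {z. q z \<noteq> 0}"
  shows "sep_generator q (\<lambda>\<xi>. f \<xi> + c * g \<xi>) = (\<lambda>\<xi>. sep_generator q f \<xi> + c * sep_generator q g \<xi>)"
proof
  fix \<xi>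
  obtain A B where "finite A" "depends_on A f" "finite B" "depends_on B g"
    using assms(1,2) unfolding local_fun_iff by blast
  then have AB: "finite (A \<union> B)" and f: "depends_on (A \<union> B) f" and g: "depends_on (A \<union> B) g"
    by (auto intro: depends_on_mono)
  have fg: "depends_on (A \<union> B) (\<lambda>\<xi>. f \<xi> + c * g \<xi>)"
    by (rule depends_on_binop[OF f g, of "\<lambda>s t. s + c * t"])
  show "sep_generator q (\<lambda>\<xi>. f \<xi> + c * g \<xi>) \<xi> = sep_generator q f \<xi> + c * sep_generator q g \<xi>"
    unfolding sep_generator_eq_sum[OF AB fg assms(3) subset_refl] sep_generator_eq_sum[OF AB f assms(3) subset_refl]
      sep_generator_eq_sum[OF AB g assms(3) subset_refl] sum_distrib_left sum.distrib[symmetric]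
    by (intro sum.cong) (auto simp: algebra_simps)
qed

lemma sep_generator_rate_linear:
  assumes "local_fun f" "finite {z. q z \<noteq> 0}" "finite {z. r z \<noteq> 0}"
  shows "sep_generator (\<lambda>z. a * q z + b * r z) f \<xi> = a * sep_generator q f \<xi> + b * sep_generator r f \<xi>"
proof -
  let ?Z = "{z. q z \<noteq> 0} \<union> {z. r z \<noteq> 0}"
  obtain A where A: "finite A" "depends_on A f"
    using assms(1) local_fun_iff by blast
  have Z: "finite ?Z" "{z. a * q z + b * r z \<noteq> 0} \<subseteq> ?Z" "{z. q z \<noteq> 0} \<subseteq> ?Z" "{z. r z \<noteq> 0} \<subseteq> ?Z"
    using assms by auto
  show ?thesis
    unfolding sep_generator_eq_sum[OF A Z(1,2)] sep_generator_eq_sum[OF A Z(1,3)]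
      sep_generator_eq_sum[OF A Z(1,4)] sum_distrib_left sum.distrib[symmetric]
    by (intro sum.cong) (auto simp: algebra_simps)
qed

text \<open>Translations and the reflection are treated at once: relabelling the sites conjugates
  exchanges into exchanges, and the condition on the rates says how jumps are relabelled.\<close>

lemma sep_generator_permute:
  assumes "bij \<sigma>" "\<And>a b. q (\<sigma> b - \<sigma> a) = r (b - a)"
  shows "sep_generator q (\<lambda>\<xi>. f (\<xi> \<circ> \<sigma>)) \<xi> = sep_generator r f (\<xi> \<circ> \<sigma>)"
proof -
  let ?u = "\<lambda>(x, y). q (y - x) * of_bool (\<xi> x) * (1 - of_bool (\<xi> y)) *
    (f (exchange x y \<xi> \<circ> \<sigma>) - f (\<xi> \<circ> \<sigma>))"
  have inj: "\<sigma> a = \<sigma> b \<longleftrightarrow> a = b" for a b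
    using assms(1) by (simp add: bij_is_inj inj_eq)
  have ex: "exchange (\<sigma> a) (\<sigma> b) \<xi> \<circ> \<sigma> = exchange a b (\<xi> \<circ> \<sigma>)" for a b
    by (auto simp: exchange_def fun_eq_iff inj)
  have "bij (map_prod \<sigma> \<sigma>)"
    using bij_betw_map_prod[OF assms(1) assms(1)] by simp
  then have "infsum ?u UNIV = (\<Sum>\<^sub>\<infinity>w. ?u (map_prod \<sigma> \<sigma> w))"
    by (rule infsum_reindex_bij_betw[symmetric])
  also have "\<dots> = sep_generator r f (\<xi> \<circ> \<sigma>)"
    unfolding sep_generator_def by (intro infsum_cong) (auto simp: assms(2) ex)
  finally show ?thesis
    by (simp add: sep_generator_def)
qed

lemma sep_generator_translate: "sep_generator q (translate x f) = translate x (sep_generator q f)"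
  unfolding translate_comp by (intro ext sep_generator_permute) (auto simp: bij_def)

text \<open>Reflection reverses the rate, and so does passing to the adjoint; this coincidence makes
  the reflection conjugate \<open>L\<close> to its adjoint.\<close>

lemma sep_generator_reflect:
  "sep_generator q (reflect f) = reflect (sep_generator (\<lambda>z. q (- z)) f)"
  unfolding reflect_comp by (intro ext sep_generator_permute) (auto simp: bij_uminus)

section \<open>The adjoint of the generator\<close>

lemma L2_prod_sum_left:
  assumes "\<And>i. i \<in> I \<Longrightarrow> local_fun (g i)" "local_fun f"
  shows "L2_prod \<theta> (\<lambda>\<xi>. \<Sum>i\<in>I. c i * g i \<xi>) f = (\<Sum>i\<in>I. c i * L2_prod \<theta> (g i) f)"
proof -
  have "mean \<theta> (\<lambda>\<xi>. \<Sum>i\<in>I. c i * (g i \<xi> * f \<xi>)) = (\<Sum>i\<in>I. mean \<theta> (\<lambda>\<xi>. c i * (g i \<xi> * f \<xi>)))"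
    using assms by (intro mean_sum) (auto intro!: local_fun_mult)
  then show ?thesis
    by (simp add: L2_prod_def sum_distrib_right mult.assoc)
qed

text \<open>Exchanging \<open>x\<close> and \<open>x + z\<close> turns the gain term of \<open>q\<close> into that of the reversed rate. The loss
  terms differ by the discrete gradient of \<open>h\<close>, whose sum over the sites vanishes.\<close>

lemma L2_prod_sep_generator_adjoint:
  fixes f g :: "('n::finite) obs"
  assumes f: "local_fun f" and g: "local_fun g" and q: "finite {z. q z \<noteq> 0}"
  shows "L2_prod \<theta> (sep_generator q f) g = L2_prod \<theta> f (sep_generator (\<lambda>z. q (- z)) g)"
proof -
  obtain A B where "finite A" "depends_on A f" "finite B" "depends_on B g"
    using f g unfolding local_fun_iff by blast
  then obtain C where C: "finite C" "depends_on C f" "depends_on C g"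
    by (metis depends_on_mono finite_UnI sup_ge1 sup_ge2)
  define Z where "Z = {z. q z \<noteq> 0}"
  define S where "S = Sigma Z (jump_sites C)"
  define h where "h = (\<lambda>x. mean \<theta> (\<lambda>\<xi>. of_bool (\<xi> x) * (f \<xi> * g \<xi>)))"
  \<comment> \<open>The value of \<open>h\<close> off \<open>C\<close>, where \<xi>(x) is
    independent of the product of \<open>f\<close> and \<open>g\<close>.\<close>
  define m where "m = pmf (bernoulli_pmf \<theta>) True * mean \<theta> (\<lambda>\<xi>. f \<xi> * g \<xi>)"
  have Z: "finite Z" "{z. q z \<noteq> 0} \<subseteq> Z" "finite (uminus ` Z)" "{z. q (- z) \<noteq> 0} \<subseteq> uminus ` Z"
    using q by (auto simp: Z_def intro!: image_eqI[of _ uminus "- _"])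
  have gen_f: "sep_generator q f = (\<lambda>\<xi>. \<Sum>w\<in>S. q (fst w) *
      (allowed (snd w) (snd w + fst w) \<xi> * (f (exchange (snd w) (snd w + fst w) \<xi>) - f \<xi>)))"
    unfolding sep_generator_eq_sum[OF C(1,2) Z(1,2), abs_def] S_def by (simp add: case_prod_unfold)
  have gen_g: "sep_generator (\<lambda>z. q (- z)) g = (\<lambda>\<xi>. \<Sum>w\<in>S. q (fst w) *
      (allowed (snd w + fst w) (snd w) \<xi> * (g (exchange (snd w) (snd w + fst w) \<xi>) - g \<xi>)))"
  proof
    fix \<xi>
    let ?u = "\<lambda>(z, x). q (- z) * (allowed x (x + z) \<xi> * (g (exchange x (x + z) \<xi>) - g \<xi>))"
    \<comment> \<open>Each jump from \<open>x\<close> to \<open>x + z\<close> is paired with its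
      reversal, which starts at \<open>x + z\<close> and has displacement
      \<open>- z\<close>.\<close>
    have "Sigma (uminus ` Z) (jump_sites C) = (\<lambda>(z, x). (- z, x + z)) ` S"
      by (force simp: S_def shift_jump_sites[symmetric] image_iff)
    then have "sep_generator (\<lambda>z. q (- z)) g \<xi> = (\<Sum>w\<in>(\<lambda>(z, x). (- z, x + z)) ` S. ?u w)"
      unfolding sep_generator_eq_sum[OF C(1,3) Z(3,4)] by simp
    also have "\<dots> = (\<Sum>w\<in>S. ?u ((\<lambda>(z, x). (- z, x + z)) w))"
      by (subst sum.reindex) (auto simp: inj_on_def)
    also have "\<dots> = (\<Sum>w\<in>S. q (fst w) *
      (allowed (snd w + fst w) (snd w) \<xi> * (g (exchange (snd w) (snd w + fst w) \<xi>) - g \<xi>)))"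
      by (intro sum.cong) (auto simp: exchange_commute)
    finally show "sep_generator (\<lambda>z. q (- z)) g \<xi> = \<dots>" .
  qed
  have swap: "mean \<theta> (\<lambda>\<xi>. allowed x y \<xi> * (f (exchange x y \<xi>) * g \<xi>))
      = mean \<theta> (\<lambda>\<xi>. allowed y x \<xi> * (f \<xi> * g (exchange x y \<xi>)))" for x y
    using mean_exchange[of "\<lambda>\<xi>. allowed x y \<xi> * (f (exchange x y \<xi>) * g \<xi>)" \<theta> x y] f g
    by (simp add: allowed_exchange local_fun_mult local_fun_exchange)
  have exchange_term: "L2_prod \<theta> (\<lambda>\<xi>. allowed x y \<xi> * (f (exchange x y \<xi>) - f \<xi>)) g
      = L2_prod \<theta> (\<lambda>\<xi>. allowed y x \<xi> * (g (exchange x y \<xi>) - g \<xi>)) f + (h y - h x)" for x y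
  proof -
    have "L2_prod \<theta> (\<lambda>\<xi>. allowed x y \<xi> * (f (exchange x y \<xi>) - f \<xi>)) g
        = mean \<theta> (\<lambda>\<xi>. allowed x y \<xi> * (f (exchange x y \<xi>) * g \<xi>) - allowed x y \<xi> * (f \<xi> * g \<xi>))"
      by (simp add: L2_prod_def algebra_simps)
    also have "\<dots> = mean \<theta> (\<lambda>\<xi>. allowed y x \<xi> * (f \<xi> * g (exchange x y \<xi>)))
        - mean \<theta> (\<lambda>\<xi>. allowed x y \<xi> * (f \<xi> * g \<xi>))"
      using f g by (subst mean_diff) (auto simp: swap local_fun_mult local_fun_exchange)
    \<comment> \<open>This uses
      \<open>allowed x y - allowed y x = \<xi>(x) - \<xi>(y)\<close>.\<close>
    also have "mean \<theta> (\<lambda>\<xi>. allowed x y \<xi> * (f \<xi> * g \<xi>)) = mean \<theta> (\<lambda>\<xi>.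
        (allowed y x \<xi> * (f \<xi> * g \<xi>) - of_bool (\<xi> y) * (f \<xi> * g \<xi>)) + of_bool (\<xi> x) * (f \<xi> * g \<xi>))"
      by (simp add: allowed_def algebra_simps)
    also have "\<dots> = mean \<theta> (\<lambda>\<xi>. allowed y x \<xi> * (f \<xi> * g \<xi>)) - h y + h x"
      using f g unfolding h_def
      by (simp add: mean_add mean_diff local_fun_diff local_fun_mult)
    also have "mean \<theta> (\<lambda>\<xi>. allowed y x \<xi> * (f \<xi> * g (exchange x y \<xi>)))
        - (mean \<theta> (\<lambda>\<xi>. allowed y x \<xi> * (f \<xi> * g \<xi>)) - h y + h x)
      = mean \<theta> (\<lambda>\<xi>. allowed y x \<xi> * (f \<xi> * g (exchange x y \<xi>)) - allowed y x \<xi> * (f \<xi> * g \<xi>))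
        + (h y - h x)"
      using f g by (subst mean_diff) (auto simp: local_fun_mult local_fun_exchange)
    finally show ?thesis
      by (simp add: L2_prod_def algebra_simps)
  qed
  have h_out: "h x = m" if "x \<notin> C" for x
  proof -
    have "depends_on {x} (\<lambda>\<xi>. of_bool (\<xi> x))"
      by (simp add: depends_on_def)
    moreover have "depends_on C (\<lambda>\<xi>. f \<xi> * g \<xi>)"
      by (rule depends_on_binop[OF C(2,3)])
    moreover have "mean \<theta> (\<lambda>\<xi>. of_bool (\<xi> x)) = pmf (bernoulli_pmf \<theta>) True"
      using occupied_integral(2)[of "{x}" \<theta>] by (simp add: occupied_single[abs_def])
    ultimately show ?thesis
      using mean_mult_disjoint[of "{x}" _ C] that C(1) by (simp add: h_def m_def)
  qed
  have grad: "(\<Sum>x\<in>jump_sites C z. h (x + z) - h x) = 0" for z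
  proof -
    \<comment> \<open>Once \<open>m\<close> is subtracted, \<open>h\<close> is supported in
      \<open>C\<close>, so the shifted and the unshifted sum both reduce to the sum over
      \<open>C\<close>.\<close>
    have "(\<Sum>x\<in>jump_sites C z. h (x + z) - m) = (\<Sum>x\<in>jump_sites C (- z). h x - m)"
      unfolding shift_jump_sites[symmetric] by (subst sum.reindex) auto
    also have "\<dots> = (\<Sum>x\<in>C. h x - m)"
      using C(1) h_out by (intro sum.mono_neutral_right) (auto simp: jump_sites_def)
    also have "\<dots> = (\<Sum>x\<in>jump_sites C z. h x - m)"
      using C(1) h_out by (intro sum.mono_neutral_left) (auto simp: jump_sites_def)
    finally show ?thesis
      by (simp add: sum_subtractf)
  qed
  have "(\<Sum>w\<in>S. q (fst w) * (h (snd w + fst w) - h (snd w)))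
      = (\<Sum>z\<in>Z. \<Sum>x\<in>jump_sites C z. q z * (h (x + z) - h x))"
    unfolding S_def using Z(1) C(1) by (simp add: sum.Sigma case_prod_unfold)
  also have "\<dots> = 0"
    by (simp add: grad flip: sum_distrib_left)
  finally have "(\<Sum>w\<in>S. q (fst w) * (h (snd w + fst w) - h (snd w))) = 0" .
  then have "L2_prod \<theta> (sep_generator q f) g = (\<Sum>w\<in>S. q (fst w) *
      L2_prod \<theta> (\<lambda>\<xi>. allowed (snd w + fst w) (snd w) \<xi> * (g (exchange (snd w) (snd w + fst w) \<xi>) - g \<xi>)) f)"
    unfolding gen_f using f g
    by (subst L2_prod_sum_left)
      (auto simp: exchange_term distrib_left sum.distrib local_fun_mult local_fun_diff local_fun_exchange)
  also have "\<dots> = L2_prod \<theta> (sep_generator (\<lambda>z. q (- z)) g) f"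
    unfolding gen_g using f g
    by (subst L2_prod_sum_left)
      (auto simp: local_fun_mult local_fun_diff local_fun_exchange)
  finally show ?thesis
    by (simp add: L2_prod_commute)
qed

lemma prod0_sep_generator_adjoint:
  assumes "local_fun f" "local_fun g" "finite {z. q z \<noteq> 0}"
  shows "prod0 \<rho> (sep_generator q f) g = prod0 \<rho> f (sep_generator (\<lambda>z. q (- z)) g)"
  using assms by (simp add: prod0_def L2_prod_sep_generator_adjoint sep_generator_translate)

text \<open>The conservation law: inflow from \<open>x - z\<close> minus outflow to
  \<open>x + z\<close>.\<close>

lemma sep_generator_site:
  assumes q: "finite {z. q z \<noteq> 0}" "q 0 = 0"
  shows "sep_generator q (\<lambda>\<xi>. of_bool (\<xi> x)) \<xi>
    = (\<Sum>z\<in>{z. q z \<noteq> 0}. q z * (allowed (x - z) x \<xi> - allowed x (x + z) \<xi>))"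
proof -
  have "depends_on {x} (\<lambda>\<xi>. of_bool (\<xi> x) :: real)"
    by (simp add: depends_on_def)
  from sep_generator_eq_sum[OF _ this q(1) subset_refl]
  have "sep_generator q (\<lambda>\<xi>. of_bool (\<xi> x)) \<xi> = (\<Sum>z\<in>{z. q z \<noteq> 0}. \<Sum>y\<in>jump_sites {x} z.
      q z * (allowed y (y + z) \<xi> * (of_bool (exchange y (y + z) \<xi> x) - of_bool (\<xi> x))))"
    using q(1) by (simp add: sum.Sigma)
  also have "\<dots> = (\<Sum>z\<in>{z. q z \<noteq> 0}. q z * (allowed (x - z) x \<xi> - allowed x (x + z) \<xi>))"
  proof (rule sum.cong[OF refl])
    fix z assume "z \<in> {z. q z \<noteq> 0}"
    then have "z \<noteq> 0"
      using q(2) by auto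
    \<comment> \<open>Since \<open>z\<close> is nonzero, the two starting points differ and the
      inner sum has exactly two terms.\<close>
    then have "jump_sites {x} z = {x, x - z}" "x \<noteq> x - z"
      by (auto simp: jump_sites_def)
    then show "(\<Sum>y\<in>jump_sites {x} z.
        q z * (allowed y (y + z) \<xi> * (of_bool (exchange y (y + z) \<xi> x) - of_bool (\<xi> x))))
      = q z * (allowed (x - z) x \<xi> - allowed x (x + z) \<xi>)"
      using \<open>z \<noteq> 0\<close> by (auto simp: allowed_def exchange_def)
  qed
  finally show ?thesis .
qed

section \<open>First moments\<close>

text \<open>Subtracting \<rho> keeps \<open>t_coeff\<close> unchanged on centered functions, and for
  densities in [0,1] it gives finite sums on all local functions, so that monomials can be treated
  one by one.\<close>

definition moment :: "real \<Rightarrow> 'n \<Rightarrow> ('n::finite) obs \<Rightarrow> real" where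
  "moment \<rho> k f = (\<Sum>\<^sub>\<infinity>x. of_int (x $ k) * L2_prod \<rho> f (\<lambda>\<xi>. of_bool (\<xi> x) - \<rho>))"

lemma L2_prod_site_outside:
  assumes "finite A" "depends_on A f" "x \<notin> A" "0 \<le> \<rho>" "\<rho> \<le> 1"
  shows "L2_prod \<rho> f (\<lambda>\<xi>. of_bool (\<xi> x) - \<rho>) = 0"
proof -
  have "depends_on {x} (\<lambda>\<xi>. of_bool (\<xi> x) - \<rho>)"
    by (simp add: depends_on_def)
  moreover have "mean \<rho> (\<lambda>\<xi>. of_bool (\<xi> x) - \<rho>) = 0"
    using mean_occupied_site[of "{}" \<rho> x] assms by simp
  ultimately show ?thesis
    using mean_mult_disjoint[of A f "{x}"] assms by (simp add: L2_prod_def)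
qed

lemma finite_moment_support:
  assumes "local_fun f" "0 \<le> \<rho>" "\<rho> \<le> 1"
  shows "finite {x. L2_prod \<rho> f (\<lambda>\<xi>. of_bool (\<xi> x) - \<rho>) \<noteq> 0}"
proof -
  obtain A where A: "finite A" "depends_on A f"
    using assms(1) local_fun_iff by blast
  then have "{x. L2_prod \<rho> f (\<lambda>\<xi>. of_bool (\<xi> x) - \<rho>) \<noteq> 0} \<subseteq> A"
    using L2_prod_site_outside assms by blast
  then show ?thesis
    using A(1) finite_subset by blast
qed

lemma moment_linear:
  assumes "local_fun f" "local_fun g" "0 \<le> \<rho>" "\<rho> \<le> 1"
  shows "moment \<rho> k (\<lambda>\<xi>. f \<xi> + c * g \<xi>) = moment \<rho> k f + c * moment \<rho> k g"
proof -
  have s: "(\<lambda>x. of_int (x $ k) * L2_prod \<rho> h (\<lambda>\<xi>. of_bool (\<xi> x) - \<rho>)) summable_on UNIV"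
    if "local_fun h" for h :: "'a obs"
    by (rule finite_nonzero_values_imp_summable_on)
      (rule finite_subset[OF _ finite_moment_support[OF that assms(3,4)]], auto)
  have "moment \<rho> k (\<lambda>\<xi>. f \<xi> + c * g \<xi>) = (\<Sum>\<^sub>\<infinity>x. of_int (x $ k) * L2_prod \<rho> f (\<lambda>\<xi>. of_bool (\<xi> x) - \<rho>)
      + c * (of_int (x $ k) * L2_prod \<rho> g (\<lambda>\<xi>. of_bool (\<xi> x) - \<rho>)))"
    unfolding moment_def using assms(1,2)
    by (intro infsum_cong, subst L2_prod_linear_left) (auto simp: algebra_simps local_fun_diff)
  also have "\<dots> = moment \<rho> k f + c * moment \<rho> k g"
    unfolding moment_def using assms(1,2)
    by (simp add: s infsum_add infsum_cmult_right' summable_on_cmult_right)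
  finally show ?thesis .
qed

lemma moment_occupied:
  assumes "finite B" "0 \<le> \<rho>" "\<rho> \<le> 1"
  shows "moment \<rho> k (occupied B) = \<rho> ^ card B * (1 - \<rho>) * (\<Sum>x\<in>B. of_int (x $ k))"
proof -
  have "moment \<rho> k (occupied B)
      = (\<Sum>\<^sub>\<infinity>x. of_int (x $ k) * (of_bool (x \<in> B) * (\<rho> ^ card B * (1 - \<rho>))))"
    unfolding moment_def L2_prod_def using assms by (simp add: mean_occupied_site)
  also have "\<dots> = (\<Sum>\<^sub>\<infinity>x\<in>B. of_int (x $ k) * (\<rho> ^ card B * (1 - \<rho>)))"
    by (rule infsum_cong_neutral) auto
  finally show ?thesis
    using assms(1) by (simp add: sum_distrib_right[symmetric])
qed

lemma moment_const:
  assumes "0 \<le> \<rho>" "\<rho> \<le> 1"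
  shows "moment \<rho> k (\<lambda>_. c) = 0"
  using moment_linear[of "occupied {}" "occupied {}" \<rho> k "c - 1"] moment_occupied[of "{}" \<rho> k] assms
  by simp

lemma moment_sum:
  assumes "finite I" "\<And>i. i \<in> I \<Longrightarrow> local_fun (g i)" "0 \<le> \<rho>" "\<rho> \<le> 1"
  shows "moment \<rho> k (\<lambda>\<xi>. \<Sum>i\<in>I. c i * g i \<xi>) = (\<Sum>i\<in>I. c i * moment \<rho> k (g i))"
  using assms
proof (induction I rule: finite_induct)
  case empty
  then show ?case
    by (simp add: moment_const)
next
  case (insert i I)
  have "local_fun (\<lambda>\<xi>. \<Sum>i\<in>I. c i * g i \<xi>)"
    using insert.prems by (auto intro!: local_fun_sum local_fun_mult)
  with insert have "moment \<rho> k (\<lambda>\<xi>. (\<Sum>i\<in>I. c i * g i \<xi>) + c i * g i \<xi>)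
      = (\<Sum>i\<in>I. c i * moment \<rho> k (g i)) + c i * moment \<rho> k (g i)"
    by (subst moment_linear) auto
  with insert show ?case
    by (simp add: add.commute)
qed

lemma moment_site:
  "0 \<le> \<rho> \<Longrightarrow> \<rho> \<le> 1 \<Longrightarrow> moment \<rho> k (\<lambda>\<xi>. of_bool (\<xi> x)) = compressibility \<rho> * of_int (x $ k)"
  using moment_occupied[of "{x}" \<rho> k] by (simp add: occupied_single[abs_def] compressibility_def)

text \<open>Written in the shape \<open>f + c * g\<close> of the linearity lemmas; factors
  \<open>1 *\<close> and \<open>(- 1) *\<close> elsewhere serve the same purpose.\<close>

lemma allowed_eq: "allowed x y = (\<lambda>\<xi>. of_bool (\<xi> x) + (- 1) * occupied {x, y} \<xi>)"
  by (auto simp: allowed_def occupied_def fun_eq_iff)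

lemma moment_allowed:
  assumes "0 \<le> \<rho>" "\<rho> \<le> 1" "x \<noteq> y"
  shows "moment \<rho> k (allowed x y)
    = compressibility \<rho> * ((1 - \<rho>) * of_int (x $ k) - \<rho> * of_int (y $ k))"
proof -
  have "moment \<rho> k (allowed x y) = moment \<rho> k (\<lambda>\<xi>. of_bool (\<xi> x)) + (- 1) * moment \<rho> k (occupied {x, y})"
    unfolding allowed_eq using assms by (intro moment_linear) auto
  then show ?thesis
    using assms by (simp add: moment_site moment_occupied compressibility_def algebra_simps power2_eq_square)
qed

lemma L2_prod_site_centered:
  assumes "centered \<rho> f"
  shows "L2_prod \<rho> f (\<lambda>\<xi>. of_bool (\<xi> x) - \<rho>) = L2_prod \<rho> f (\<lambda>\<xi>. of_bool (\<xi> x))"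
  using L2_prod_linear_left[of "\<lambda>\<xi>. of_bool (\<xi> x)" "\<lambda>_. 1" f \<rho> "- \<rho>"] assms
  by (simp add: L2_prod_commute[of \<rho> f]) (simp add: centered_def L2_prod_def)

lemma t_coeff_eq_moment: "centered \<rho> f \<Longrightarrow> t_coeff \<rho> f $ k = moment \<rho> k f"
  by (simp add: t_coeff_def moment_def L2_prod_site_centered)

section \<open>The space of centered functions with vanishing derivative\<close>

lemma G_space_centered: "f \<in> G_space \<rho> \<Longrightarrow> centered \<rho> f"
  by (simp add: G_space_def centered_def)

lemma G_space_zero: "(\<lambda>_. 0) \<in> G_space \<rho>"
  by (simp add: G_space_def)

lemma G_space_linear:
  assumes "f \<in> G_space \<rho>" "g \<in> G_space \<rho>"
  shows "(\<lambda>\<xi>. f \<xi> + c * g \<xi>) \<in> G_space \<rho>"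
proof -
  have fg: "local_fun f" "local_fun g"
    using assms by (auto simp: G_space_def)
  have m: "mean \<theta> (\<lambda>\<xi>. f \<xi> + c * g \<xi>) = mean \<theta> f + c * mean \<theta> g" for \<theta>
    using fg by (simp add: mean_add local_fun_mult)
  have "((\<lambda>\<theta>. mean \<theta> f + c * mean \<theta> g) has_real_derivative 0 + c * 0) (at \<rho> within {0..1})"
    using assms by (intro DERIV_add DERIV_cmult) (auto simp: G_space_def)
  then show ?thesis
    using assms fg by (auto simp: G_space_def m intro!: local_fun_add local_fun_mult)
qed

lemma G_space_scale: "f \<in> G_space \<rho> \<Longrightarrow> (\<lambda>\<xi>. c * f \<xi>) \<in> G_space \<rho>"
  using G_space_linear[OF G_space_zero] by simp

lemma G_space_reflect: "f \<in> G_space \<rho> \<Longrightarrow> reflect f \<in> G_space \<rho>"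
  by (simp add: G_space_def)

lemma translate_occupied: "translate x (occupied B) = occupied ((+) x ` B)"
  by (simp add: translate_comp occupied_permute)

lemma reflect_occupied: "reflect (occupied B) = occupied (uminus ` B)"
  by (simp add: reflect_comp occupied_permute)

text \<open>Up to the factor \<rho>(1 - \<rho>), the derivative of the mean at \<rho> is the sum of
  covariances with the occupation variables, which is this pairing. Hence gradients are orthogonal
  to \<open>G_space\<close>.\<close>

lemma prod0_site_G_space:
  assumes "f \<in> G_space \<rho>" "0 < \<rho>" "\<rho> < 1"
  shows "prod0 \<rho> (\<lambda>\<xi>. of_bool (\<xi> x)) f = 0"
proof -
  have f: "local_fun f" "mean \<rho> f = 0" and
    deriv: "((\<lambda>\<theta>. mean \<theta> f) has_real_derivative 0) (at \<rho> within {0..1})"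
    using assms(1) by (auto simp: G_space_def)
  obtain A where A: "finite A" "depends_on A f"
    using f(1) local_fun_iff by blast
  have c: "L2_prod \<rho> f (\<lambda>\<xi>. of_bool (\<xi> y) - \<rho>) = L2_prod \<rho> f (\<lambda>\<xi>. of_bool (\<xi> y))" for y
    by (rule L2_prod_site_centered[OF G_space_centered[OF assms(1)]])
  \<comment> \<open>At an interior density the derivative within [0,1] is an ordinary one, hence
    unique.\<close>
  have "(\<Sum>y\<in>A. mean \<rho> (\<lambda>\<xi>. f \<xi> * (of_bool (\<xi> y) - \<rho>))) / (\<rho> * (1 - \<rho>)) = 0"
    using mean_has_derivative[OF A assms(2,3)] deriv assms(2,3)
    by (intro DERIV_unique[of "\<lambda>\<theta>. mean \<theta> f" _ \<rho>]) (simp_all add: at_within_Icc_at)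
  then have 0: "(\<Sum>y\<in>A. L2_prod \<rho> f (\<lambda>\<xi>. of_bool (\<xi> y))) = 0"
    using assms(2,3) c by (simp add: L2_prod_def)
  have "prod0 \<rho> (\<lambda>\<xi>. of_bool (\<xi> x)) f = prod0 \<rho> (translate x (\<lambda>\<xi>. of_bool (\<xi> 0))) f"
    by (simp add: translate_def[abs_def])
  also have "\<dots> = prod0 \<rho> f (\<lambda>\<xi>. of_bool (\<xi> 0))"
    using f(1) by (simp only: prod0_translate_left prod0_commute[of "\<lambda>\<xi>. of_bool (\<xi> 0)" f] local_fun_site)
  also have "\<dots> = (\<Sum>\<^sub>\<infinity>y. L2_prod \<rho> f (\<lambda>\<xi>. of_bool (\<xi> y)))"
    by (simp add: prod0_def translate_def[abs_def])
  also have "\<dots> = (\<Sum>\<^sub>\<infinity>y\<in>A. L2_prod \<rho> f (\<lambda>\<xi>. of_bool (\<xi> y)))"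
    using L2_prod_site_outside[OF A, of _ \<rho>] assms(2,3) by (intro infsum_cong_neutral) (auto simp flip: c)
  finally show ?thesis
    using A(1) 0 by simp
qed

text \<open>Expand \<open>allowed x y\<close> as \<xi>(x) - \<xi>(x)\<xi>(y): the site term drops
  out and the pair is translated to the origin.\<close>

lemma prod0_allowed_G_space:
  assumes "f \<in> G_space \<rho>" "0 < \<rho>" "\<rho> < 1"
  shows "prod0 \<rho> (allowed x y) f = - prod0 \<rho> (occupied {0, y - x}) f"
proof -
  have "translate x (occupied {0, y - x}) = occupied {x, y}"
    by (simp add: translate_occupied)
  then have "prod0 \<rho> (occupied {x, y}) f = prod0 \<rho> (occupied {0, y - x}) f"
    using prod0_translate_left[of f "occupied {0, y - x}" \<rho> x] G_space_centered[OF assms(1)] by auto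
  then show ?thesis
    unfolding allowed_eq using assms G_space_centered[OF assms(1)]
    by (subst prod0_linear_left) (auto simp: prod0_site_G_space)
qed

section \<open>Currents\<close>

text \<open>The substitution of \<open>- z\<close> for \<open>z\<close> in the second half of the
  current turns its rate into \<open>pmf p z\<close> and its sign into a plus.\<close>

lemma current_eq_sum:
  assumes "finite (set_pmf p)"
  shows "current p i = (\<lambda>\<xi>. \<Sum>z\<in>set_pmf p. pmf p z * of_int (z $ i) / 2 * (allowed 0 z \<xi> + 1 * allowed (- z) 0 \<xi>))"
proof
  fix \<xi>
  \<comment> \<open>A symmetric range of summation, so that the substitution maps it onto
    itself.\<close>
  define Z where "Z = set_pmf p \<union> uminus ` set_pmf p"
  have Z: "finite Z" "uminus ` Z = Z" "set_pmf p \<subseteq> Z"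
    using assms by (auto simp: Z_def image_Un image_image)
  have out: "pmf p z = 0" "pmf p (- z) = 0" if "z \<notin> Z" for z
    using that by (force simp: Z_def set_pmf_iff)+
  let ?u = "\<lambda>z. pmf p z * of_int (z $ i) * allowed 0 z \<xi>"
  let ?v = "\<lambda>z. pmf p z * of_int (z $ i) * allowed (- z) 0 \<xi>"
  have "2 * current p i \<xi> = (\<Sum>\<^sub>\<infinity>z. ?u z + ?v (- z))"
    unfolding current_def by (simp add: allowed_def mult.assoc)
  also have "\<dots> = (\<Sum>\<^sub>\<infinity>z\<in>Z. ?u z + ?v (- z))"
    using out by (intro infsum_cong_neutral) auto
  also have "\<dots> = (\<Sum>z\<in>Z. ?u z) + (\<Sum>z\<in>Z. ?v (- z))"
    using Z(1) by (simp only: infsum_finite sum.distrib)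
  also have "(\<Sum>z\<in>Z. ?v (- z)) = (\<Sum>z\<in>uminus ` Z. ?v z)"
    by (subst sum.reindex) auto
  also have "(\<Sum>z\<in>Z. ?u z) + (\<Sum>z\<in>uminus ` Z. ?v z) = (\<Sum>z\<in>Z. ?u z + ?v z)"
    by (simp add: Z(2) sum.distrib)
  also have "\<dots> = (\<Sum>z\<in>set_pmf p. ?u z + ?v z)"
    using Z by (intro sum.mono_neutral_right) (auto simp: set_pmf_iff)
  finally show "current p i \<xi>
      = (\<Sum>z\<in>set_pmf p. pmf p z * of_int (z $ i) / 2 * (allowed 0 z \<xi> + 1 * allowed (- z) 0 \<xi>))"
    by (simp add: algebra_simps sum_distrib_left)
      (simp add: sum_divide_distrib[symmetric] sum.distrib add_divide_distrib)
qed

text \<open>Constants and multiples of \<xi>(0) have zero first moments, and at interior densities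
  they pair to zero with \<open>G_space\<close>; so \<open>a\<close> and \<open>b\<close> are left
  unspecified.\<close>

lemma norm_current_affine:
  obtains a b where "norm_current p \<rho> i = (\<lambda>\<xi>. (current p i \<xi> + a * 1) + b * of_bool (\<xi> 0))"
proof
  let ?d = "vector_derivative (\<lambda>\<theta>. mean \<theta> (current p i)) (at \<rho> within {0..1})"
  show "norm_current p \<rho> i
      = (\<lambda>\<xi>. (current p i \<xi> + (\<rho> * ?d - mean \<rho> (current p i)) * 1) + (- ?d) * of_bool (\<xi> 0))"
    by (simp add: norm_current_def fun_eq_iff algebra_simps)
qed

lemma local_fun_current: "finite (set_pmf p) \<Longrightarrow> local_fun (current p i)"
  unfolding current_eq_sum
  by (intro local_fun_sum local_fun_mult local_fun_add local_fun_const local_fun_allowed)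

lemma local_fun_norm_current:
  assumes "finite (set_pmf p)"
  shows "local_fun (norm_current p \<rho> i)"
proof -
  obtain a b where ab: "norm_current p \<rho> i = (\<lambda>\<xi>. (current p i \<xi> + a * 1) + b * of_bool (\<xi> 0))"
    by (rule norm_current_affine)
  show ?thesis
    unfolding ab
    by (intro local_fun_add local_fun_mult local_fun_const local_fun_site local_fun_current assms)
qed

lemma S_matrix_eq_sum:
  assumes "finite (set_pmf p)"
  shows "S_matrix p $ i $ k = (\<Sum>z\<in>set_pmf p. pmf p z * of_int (z $ i) * of_int (z $ k)) / 2"
proof -
  have "(\<Sum>\<^sub>\<infinity>z. pmf p z * of_int (z $ i) * of_int (z $ k))
      = (\<Sum>\<^sub>\<infinity>z\<in>set_pmf p. pmf p z * of_int (z $ i) * of_int (z $ k))"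
    by (rule infsum_cong_neutral) (auto simp: set_pmf_iff)
  then show ?thesis
    using assms by (simp add: S_matrix_def)
qed

text \<open>For each \<open>z\<close> the two halves contribute - \<rho> z_k and - (1 - \<rho>) z_k
  times the compressibility, so the density cancels except in that factor.\<close>

lemma moment_norm_current:
  assumes fin: "finite (set_pmf p)" and "pmf p 0 = 0" and \<rho>: "0 \<le> \<rho>" "\<rho> \<le> 1"
  shows "moment \<rho> k (norm_current p \<rho> i) = - compressibility \<rho> * S_matrix p $ i $ k"
proof -
  obtain a b where ab: "norm_current p \<rho> i = (\<lambda>\<xi>. (current p i \<xi> + a * 1) + b * of_bool (\<xi> 0))"
    by (rule norm_current_affine)
  have loc: "local_fun (current p i)" "local_fun (\<lambda>\<xi>. current p i \<xi> + a * 1)"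
    using local_fun_current[OF fin] by (auto intro!: local_fun_add)
  have "moment \<rho> k (norm_current p \<rho> i) = moment \<rho> k (current p i)"
    unfolding ab using \<rho> loc
    by (simp only: moment_linear local_fun_site local_fun_const) (simp add: moment_site moment_const)
  also have "\<dots> = (\<Sum>z\<in>set_pmf p. pmf p z * of_int (z $ i) / 2 *
      (moment \<rho> k (allowed 0 z) + 1 * moment \<rho> k (allowed (- z) 0)))"
    unfolding current_eq_sum[OF fin] using fin \<rho>
    by (subst moment_sum) (auto simp only: moment_linear local_fun_allowed local_fun_add local_fun_mult local_fun_const)
  also have "\<dots> = (\<Sum>z\<in>set_pmf p. pmf p z * of_int (z $ i) / 2 * (- compressibility \<rho> * of_int (z $ k)))"
  proof (rule sum.cong[OF refl])
    fix z assume "z \<in> set_pmf p"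
    then have z: "0 \<noteq> z" "- z \<noteq> 0"
      using assms(2) by (auto simp: set_pmf_iff)
    show "pmf p z * of_int (z $ i) / 2 * (moment \<rho> k (allowed 0 z) + 1 * moment \<rho> k (allowed (- z) 0))
      = pmf p z * of_int (z $ i) / 2 * (- compressibility \<rho> * of_int (z $ k))"
      unfolding moment_allowed[OF \<rho> z(1)] moment_allowed[OF \<rho> z(2)] by (simp add: algebra_simps)
  qed
  also have "\<dots> = - compressibility \<rho> * S_matrix p $ i $ k"
    unfolding S_matrix_eq_sum[OF fin] by (simp add: sum_distrib_left sum_divide_distrib mult_ac sum_negf)
  finally show ?thesis .
qed

text \<open>Both halves of the current yield the same pair \<open>{0, z}\<close> up to translation,
  which absorbs the factor 1/2.\<close>

lemma prod0_norm_current: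
  assumes fin: "finite (set_pmf p)" and f: "f \<in> G_space \<rho>" and \<rho>: "0 < \<rho>" "\<rho> < 1"
  shows "prod0 \<rho> (norm_current p \<rho> i) f
    = - (\<Sum>z\<in>set_pmf p. pmf p z * of_int (z $ i) * prod0 \<rho> (occupied {0, z}) f)"
proof -
  obtain a b where ab: "norm_current p \<rho> i = (\<lambda>\<xi>. (current p i \<xi> + a * 1) + b * of_bool (\<xi> 0))"
    by (rule norm_current_affine)
  have loc: "local_fun (current p i)" "local_fun (\<lambda>\<xi>. current p i \<xi> + a * 1)"
    using local_fun_current[OF fin] by (auto intro!: local_fun_add)
  have c: "centered \<rho> f" "local_fun f" "mean \<rho> f = 0"
    using f by (auto simp: G_space_def centered_def)
  have "prod0 \<rho> (norm_current p \<rho> i) f = prod0 \<rho> (current p i) f"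
    unfolding ab using loc c f \<rho>
    by (simp only: prod0_linear_left local_fun_site local_fun_const) (simp add: prod0_site_G_space prod0_const)
  also have "\<dots> = (\<Sum>z\<in>set_pmf p. pmf p z * of_int (z $ i) / 2 *
      (prod0 \<rho> (allowed 0 z) f + 1 * prod0 \<rho> (allowed (- z) 0) f))"
    unfolding current_eq_sum[OF fin] using fin c
    by (subst prod0_sum_left) (auto simp only: prod0_linear_left local_fun_allowed local_fun_add local_fun_mult local_fun_const)
  also have "\<dots> = - (\<Sum>z\<in>set_pmf p. pmf p z * of_int (z $ i) * prod0 \<rho> (occupied {0, z}) f)"
    by (simp add: prod0_allowed_G_space[OF f \<rho>] sum_negf[symmetric] mult.assoc)
  finally show ?thesis .
qed

text \<open>Up to a translation, \<open>{0, - z}\<close> is \<open>{0, z}\<close>: modulo gradients the current is even.\<close>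

lemma prod0_norm_current_reflect:
  assumes "finite (set_pmf p)" "f \<in> G_space \<rho>" "0 < \<rho>" "\<rho> < 1"
  shows "prod0 \<rho> (norm_current p \<rho> i) (reflect f) = prod0 \<rho> (norm_current p \<rho> i) f"
proof -
  have f: "local_fun f"
    using assms(2) by (simp add: G_space_def)
  have "prod0 \<rho> (occupied {0, z}) (reflect f) = prod0 \<rho> (occupied {0, z}) f" for z :: "int ^ 'a"
  proof -
    have "prod0 \<rho> (occupied {0, z}) (reflect f) = prod0 \<rho> (reflect (occupied {0, z})) f"
      using prod0_reflect[of "reflect f" "occupied {0, z}" \<rho>] f by simp
    also have "reflect (occupied {0, z}) = translate (- z) (occupied {0, z})"
      by (simp add: reflect_occupied translate_occupied insert_commute)
    also have "prod0 \<rho> \<dots> f = prod0 \<rho> (occupied {0, z}) f"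
      using f by (simp add: prod0_translate_left)
    finally show ?thesis .
  qed
  then show ?thesis
    using assms by (simp add: prod0_norm_current G_space_reflect)
qed

section \<open>First moments of images under the generator\<close>

lemma reversed_rate_support: "{z. pmf p (- z) \<noteq> 0} = uminus ` set_pmf p"
  for p :: "(int ^ 'n::finite) pmf"
  by (auto simp: set_pmf_iff intro!: image_eqI[of _ uminus "- _"])

lemma finite_rates:
  fixes p :: "(int ^ 'n::finite) pmf"
  assumes "finite (set_pmf p)"
  shows "finite {z. pmf p z \<noteq> 0}" "finite {z. pmf p (- z) \<noteq> 0}"
  using assms by (simp_all add: reversed_rate_support flip: set_pmf_eq)

lemma infsum_finite_sum:
  fixes f :: "'i \<Rightarrow> 'b \<Rightarrow> real"
  assumes "finite I" "\<And>i. i \<in> I \<Longrightarrow> f i summable_on A"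
  shows "(\<Sum>\<^sub>\<infinity>x\<in>A. \<Sum>i\<in>I. f i x) = (\<Sum>i\<in>I. \<Sum>\<^sub>\<infinity>x\<in>A. f i x)"
proof -
  have "(\<lambda>x. \<Sum>i\<in>I. f i x) summable_on A \<and>
      (\<Sum>\<^sub>\<infinity>x\<in>A. \<Sum>i\<in>I. f i x) = (\<Sum>i\<in>I. \<Sum>\<^sub>\<infinity>x\<in>A. f i x)"
    using assms by (induction I rule: finite_induct) (simp_all add: summable_on_add infsum_add)
  then show ?thesis ..
qed

text \<open>Summation by parts; finite support lets the two sums be separated and shifted.\<close>

lemma infsum_moment_shift:
  fixes \<phi> :: "int ^ 'n::finite \<Rightarrow> real"
  assumes "finite {x. \<phi> x \<noteq> 0}"
  shows "(\<lambda>x. of_int (x $ k) * (\<phi> (x - w) - \<phi> x)) summable_on UNIV"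
    and "(\<Sum>\<^sub>\<infinity>x. of_int (x $ k) * (\<phi> (x - w) - \<phi> x)) = of_int (w $ k) * (\<Sum>\<^sub>\<infinity>x. \<phi> x)"
proof -
  have bij: "bij (\<lambda>x. x + w)"
    by (auto intro!: bij_betw_byWitness[where f' = "\<lambda>x. x - w"])
  have fin: "finite {x. \<phi> (x - w) \<noteq> 0}"
    by (rule finite_subset[OF _ finite_imageI[OF assms, of "\<lambda>x. x + w"]]) (auto simp: image_iff intro!: exI[of _ "_ - w"])
  have s: "\<phi> summable_on UNIV" "(\<lambda>x. of_int (x $ k) * \<phi> x) summable_on UNIV"
    "(\<lambda>x. of_int (x $ k) * \<phi> (x - w)) summable_on UNIV"
    by (rule finite_nonzero_values_imp_summable_on, rule finite_subset[OF _ assms] finite_subset[OF _ fin], force)+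
  have split: "of_int (x $ k) * (\<phi> (x - w) - \<phi> x) = of_int (x $ k) * \<phi> (x - w) + (- (of_int (x $ k) * \<phi> x))" for x
    by (simp add: algebra_simps)
  have minus: "(\<lambda>x. - (of_int (x $ k) * \<phi> x)) summable_on UNIV"
    unfolding summable_on_uminus by (rule s(2))
  show "(\<lambda>x. of_int (x $ k) * (\<phi> (x - w) - \<phi> x)) summable_on UNIV"
    unfolding split by (intro summable_on_add s(3) minus)
  have "(\<Sum>\<^sub>\<infinity>x. of_int (x $ k) * \<phi> (x - w)) = (\<Sum>\<^sub>\<infinity>x. of_int ((x + w) $ k) * \<phi> ((x + w) - w))"
    by (rule infsum_reindex_bij_betw[OF bij, symmetric])
  also have "\<dots> = (\<Sum>\<^sub>\<infinity>x. of_int (x $ k) * \<phi> x) + of_int (w $ k) * (\<Sum>\<^sub>\<infinity>x. \<phi> x)"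
    using s by (simp add: distrib_right infsum_add infsum_cmult_right' summable_on_cmult_right)
  finally show "(\<Sum>\<^sub>\<infinity>x. of_int (x $ k) * (\<phi> (x - w) - \<phi> x)) = of_int (w $ k) * (\<Sum>\<^sub>\<infinity>x. \<phi> x)"
    unfolding split infsum_add[OF s(3) minus] infsum_uminus by simp
qed

text \<open>Moved to the other side, the adjoint generator turns \<xi>(x) into discrete gradients,
  of single sites (\<open>h\<close>) and of pairs (\<open>F\<close>). After summation by parts the
  site part has total mass zero because \<open>u\<close> lies in \<open>G_space\<close>, and the
  pair part is the pairing with the current.\<close>

lemma t_coeff_gen:
  assumes fin: "finite (set_pmf p)" and p0: "pmf p 0 = 0" and u: "u \<in> G_space \<rho>" and \<rho>: "0 < \<rho>" "\<rho> < 1"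
  shows "t_coeff \<rho> (gen p u) $ k = - prod0 \<rho> (norm_current p \<rho> k) u"
proof -
  have lu: "local_fun u" and mu: "mean \<rho> u = 0"
    using u by (auto simp: G_space_def)
  note finp = finite_rates(1)[OF fin] and finm = finite_rates(2)[OF fin]
  define h where "h = (\<lambda>x. L2_prod \<rho> u (\<lambda>\<xi>. of_bool (\<xi> x)))"
  define F where "F = (\<lambda>z x. L2_prod \<rho> u (occupied {x, x + z}))"
  have h_eq: "h = (\<lambda>x. L2_prod \<rho> u (translate x (\<lambda>\<xi>. of_bool (\<xi> 0))))"
    by (simp add: h_def translate_def[abs_def])
  have F_eq: "F z = (\<lambda>x. L2_prod \<rho> u (translate x (occupied {0, z})))" for z
    by (simp add: F_def translate_occupied)
  have fh: "finite {x. h x \<noteq> 0}"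
    using finite_correlated_translates[OF local_fun_site lu, of \<rho> 0] mu by (simp add: h_eq)
  have fF: "finite {x. F z x \<noteq> 0}" for z
    using finite_correlated_translates[of "occupied {0, z}" u \<rho>] lu mu by (simp add: F_eq)
  have h0: "(\<Sum>\<^sub>\<infinity>x. h x) = 0"
    using prod0_commute[of u "\<lambda>\<xi>. of_bool (\<xi> 0)" \<rho>] prod0_site_G_space[OF u \<rho>] lu
    by (simp add: h_eq prod0_def)
  have F0: "(\<Sum>\<^sub>\<infinity>x. F z x) = prod0 \<rho> (occupied {0, z}) u" for z
    using prod0_commute[of u "occupied {0, z}" \<rho>] lu by (simp add: F_eq prod0_def)
  \<comment> \<open>The pair is listed as \<open>{y, x}\<close> so that, after replacing
    \<open>z\<close> by \<open>- z\<close>, it has the form \<open>{x, x + z}\<close> of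
    \<open>F\<close>.\<close>
  have all: "L2_prod \<rho> (allowed x y) u = h x - L2_prod \<rho> u (occupied {y, x})" for x y
    unfolding allowed_eq h_def insert_commute[of x y] using lu
    by (subst L2_prod_linear_left) (auto simp: L2_prod_commute[of \<rho> u])
  \<comment> \<open>The form \<open>x - - z\<close> matches \<open>x - w\<close> in
    \<open>infsum_moment_shift\<close> with \<open>w = - z\<close>.\<close>
  have site: "L2_prod \<rho> (gen p u) (\<lambda>\<xi>. of_bool (\<xi> x))
      = (\<Sum>z\<in>set_pmf p. pmf p z * ((h (x - - z) - h x) + (F z (x - z) - F z x)))" for x
  proof -
    have "L2_prod \<rho> (gen p u) (\<lambda>\<xi>. of_bool (\<xi> x))
        = L2_prod \<rho> (sep_generator (\<lambda>z. pmf p (- z)) (\<lambda>\<xi>. of_bool (\<xi> x))) u"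
      unfolding gen_def by (simp only: L2_prod_sep_generator_adjoint[OF lu local_fun_site finp] L2_prod_commute[of \<rho> u])
    also have "sep_generator (\<lambda>z. pmf p (- z)) (\<lambda>\<xi>. of_bool (\<xi> x))
        = (\<lambda>\<xi>. \<Sum>z\<in>uminus ` set_pmf p. pmf p (- z) * (allowed (x - z) x \<xi> + (- 1) * allowed x (x + z) \<xi>))"
      using finm p0 by (simp add: sep_generator_site fun_eq_iff reversed_rate_support)
    also have "L2_prod \<rho> \<dots> u = (\<Sum>z\<in>uminus ` set_pmf p. pmf p (- z) *
        (L2_prod \<rho> (allowed (x - z) x) u + (- 1) * L2_prod \<rho> (allowed x (x + z)) u))"
      using lu by (subst L2_prod_sum_left)
        (auto simp only: L2_prod_linear_left local_fun_allowed local_fun_add local_fun_mult local_fun_const)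
    also have "\<dots> = (\<Sum>z\<in>set_pmf p. pmf p z * ((h (x - - z) - h x) + (F z (x - z) - F z x)))"
      by (subst sum.reindex) (simp_all add: all F_def algebra_simps)
    finally show ?thesis .
  qed
  have "t_coeff \<rho> (gen p u) $ k = (\<Sum>\<^sub>\<infinity>x. \<Sum>z\<in>set_pmf p. pmf p z *
      (of_int (x $ k) * (h (x - - z) - h x) + of_int (x $ k) * (F z (x - z) - F z x)))"
    unfolding t_coeff_def vec_lambda_beta site sum_distrib_left
    by (intro infsum_cong sum.cong refl) (simp only: distrib_left mult.left_commute)
  also have "\<dots> = (\<Sum>z\<in>set_pmf p. \<Sum>\<^sub>\<infinity>x. pmf p z *
      (of_int (x $ k) * (h (x - - z) - h x) + of_int (x $ k) * (F z (x - z) - F z x)))"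
    by (rule infsum_finite_sum[OF fin])
      (rule summable_on_cmult_right summable_on_add infsum_moment_shift(1)[OF fh] infsum_moment_shift(1)[OF fF])+
  also have "\<dots> = (\<Sum>z\<in>set_pmf p. pmf p z * (of_int (z $ k) * prod0 \<rho> (occupied {0, z}) u))"
  proof (rule sum.cong[OF refl])
    fix z
    show "(\<Sum>\<^sub>\<infinity>x. pmf p z * (of_int (x $ k) * (h (x - - z) - h x) + of_int (x $ k) * (F z (x - z) - F z x)))
      = pmf p z * (of_int (z $ k) * prod0 \<rho> (occupied {0, z}) u)"
      unfolding infsum_cmult_right' infsum_add[OF infsum_moment_shift(1)[OF fh] infsum_moment_shift(1)[OF fF]]
        infsum_moment_shift(2)[OF fh] infsum_moment_shift(2)[OF fF] h0 F0
      by simp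
  qed
  also have "\<dots> = - prod0 \<rho> (norm_current p \<rho> k) u"
    by (simp add: prod0_norm_current[OF fin u \<rho>] mult.assoc)
  finally show ?thesis .
qed

section \<open>The Dirichlet form and the norm of fluctuations\<close>

definition dirichlet :: "(int ^ ('n::finite)) pmf \<Rightarrow> real \<Rightarrow> 'n obs \<Rightarrow> real" where
  "dirichlet p \<rho> f = prod0 \<rho> f (\<lambda>\<xi>. - gen_sym p f \<xi>)"

lemma local_fun_gen: "finite (set_pmf p) \<Longrightarrow> local_fun f \<Longrightarrow> local_fun (gen p f)"
  unfolding gen_def by (intro local_fun_sep_generator finite_rates)

lemma gen_linear:
  "finite (set_pmf p) \<Longrightarrow> local_fun f \<Longrightarrow> local_fun g \<Longrightarrow>
    gen p (\<lambda>\<xi>. f \<xi> + c * g \<xi>) = (\<lambda>\<xi>. gen p f \<xi> + c * gen p g \<xi>)"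
  unfolding gen_def by (intro sep_generator_linear finite_rates)

text \<open>With \<open>R\<close> the reflection and \<open>L*\<close> the adjoint,
  \<open>L* R = R L\<close>, so \<open>L\<close> can be moved to the other factor while
  \<open>R\<close> changes sides. This is the source of the symmetry of \<open>D\<close>.\<close>

lemma prod0_gen_reflect:
  assumes "finite (set_pmf p)" "local_fun u" "local_fun v"
  shows "prod0 \<rho> (gen p u) (reflect v) = prod0 \<rho> (gen p v) (reflect u)"
proof -
  have "prod0 \<rho> (gen p u) (reflect v) = prod0 \<rho> u (sep_generator (\<lambda>z. pmf p (- z)) (reflect v))"
    unfolding gen_def using assms finite_rates[OF assms(1)] by (simp add: prod0_sep_generator_adjoint)
  also have "\<dots> = prod0 \<rho> (reflect (reflect u)) (reflect (gen p v))"
    by (simp add: sep_generator_reflect gen_def)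
  also have "\<dots> = prod0 \<rho> (reflect u) (gen p v)"
    using assms by (intro prod0_reflect local_fun_reflect local_fun_gen)
  also have "\<dots> = prod0 \<rho> (gen p v) (reflect u)"
    using assms by (intro prod0_commute local_fun_reflect local_fun_gen)
  finally show ?thesis .
qed

text \<open>The symmetric part is half the sum of \<open>L\<close> and its adjoint, and these two
  have the same quadratic form.\<close>

lemma dirichlet_eq:
  assumes fin: "finite (set_pmf p)" and f: "centered \<rho> f"
  shows "dirichlet p \<rho> f = - prod0 \<rho> (gen p f) f"
proof -
  let ?L = "sep_generator (pmf p) f" and ?M = "sep_generator (\<lambda>z. pmf p (- z)) f"
  have lf: "local_fun f"
    using f by blast
  have loc: "local_fun ?L" "local_fun ?M"
    using lf finite_rates[OF fin] by (auto intro: local_fun_sep_generator)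
  have sym: "sym_rate p = (\<lambda>z. 1 / 2 * pmf p z + 1 / 2 * pmf p (- z))"
    by (simp add: sym_rate_def fun_eq_iff add_divide_distrib)
  have "(\<lambda>\<xi>. - gen_sym p f \<xi>) = (\<lambda>\<xi>. (0 + (- 1 / 2) * ?L \<xi>) + (- 1 / 2) * ?M \<xi>)"
    unfolding gen_sym_def sym using sep_generator_rate_linear[OF lf finite_rates[OF fin], of "1 / 2" "1 / 2"]
    by (simp add: fun_eq_iff)
  then have "dirichlet p \<rho> f = prod0 \<rho> f (\<lambda>\<xi>. (0 + (- 1 / 2) * ?L \<xi>) + (- 1 / 2) * ?M \<xi>)"
    by (simp only: dirichlet_def)
  also have "\<dots> = prod0 \<rho> (\<lambda>\<xi>. (0 + (- 1 / 2) * ?L \<xi>) + (- 1 / 2) * ?M \<xi>) f"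
    by (intro prod0_commute local_fun_add local_fun_mult local_fun_const loc lf)
  also have "\<dots> = - 1 / 2 * prod0 \<rho> ?L f - 1 / 2 * prod0 \<rho> ?M f"
  proof -
    have "local_fun (\<lambda>\<xi>. 0 + (- 1 / 2) * ?L \<xi>)"
      by (intro local_fun_add local_fun_mult local_fun_const loc)
    then show ?thesis
      using f lf loc by (simp only: prod0_linear_left local_fun_const) (simp add: prod0_const centered_def)
  qed
  also have "prod0 \<rho> ?M f = prod0 \<rho> f ?L"
    using prod0_sep_generator_adjoint[OF lf lf finite_rates(2)[OF fin]] by simp
  also have "\<dots> = prod0 \<rho> ?L f"
    by (rule prod0_commute[OF loc(1) lf])
  finally show ?thesis
    by (simp add: gen_def)
qed

text \<open>The case \<open>u = reflect f\<close>, \<open>v = f\<close> of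
  \<open>prod0_gen_reflect\<close>. It allows error bounds to be applied to reflected
  functions.\<close>

lemma dirichlet_reflect:
  assumes "finite (set_pmf p)" "centered \<rho> f"
  shows "dirichlet p \<rho> (reflect f) = dirichlet p \<rho> f"
  using prod0_gen_reflect[OF assms(1), of "reflect f" f] assms
  by (simp add: dirichlet_eq centered_reflect centered_local)

section \<open>Linear bounds extracted from the norm of fluctuations\<close>

lemma sep_generator_scale: "sep_generator q (\<lambda>\<xi>. c * f \<xi>) \<xi> = c * sep_generator q f \<xi>"
  unfolding sep_generator_def infsum_cmult_right'[symmetric]
  by (intro infsum_cong) (auto simp: algebra_simps)

lemma prod0_scale_left: "prod0 \<rho> (\<lambda>\<xi>. c * g \<xi>) f = c * prod0 \<rho> g f"
  by (simp add: prod0_def L2_prod_def mult.assoc infsum_cmult_right')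

lemma prod0_scale_right: "prod0 \<rho> g (\<lambda>\<xi>. c * f \<xi>) = c * prod0 \<rho> g f"
  by (simp add: prod0_def L2_prod_def translate_def mult.left_commute infsum_cmult_right')

lemma dirichlet_scale: "dirichlet p \<rho> (\<lambda>\<xi>. c * f \<xi>) = c\<^sup>2 * dirichlet p \<rho> f"
  using prod0_scale_right[of \<rho> f c "\<lambda>\<xi>. - gen_sym p f \<xi>"]
  by (simp add: dirichlet_def gen_sym_def sep_generator_scale prod0_scale_left power2_eq_square)

text \<open>A quadratic polynomial in \<open>s\<close> that is bounded above has a nonpositive
  leading coefficient, and its maximum controls the linear one. It will be applied to multiples of
  one test function or of one vector.\<close>

lemma quadratic_bound:
  fixes b q \<epsilon> :: real
  assumes "\<epsilon> \<ge> 0" and bound: "\<And>s. 2 * (s * b) - s\<^sup>2 * q \<le> \<epsilon>\<^sup>2"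
  shows "0 \<le> q" and "\<bar>b\<bar> \<le> \<epsilon> * sqrt q"
proof -
  show q: "0 \<le> q"
  proof (rule ccontr)
    assume "\<not> 0 \<le> q"
    \<comment> \<open>Chosen so that the quadratic term alone exceeds the bound; adding the
      inequalities for \<open>s\<close> and \<open>- s\<close> removes the linear term.\<close>
    define s where "s = sqrt ((\<epsilon>\<^sup>2 + 1) / (- q))"
    have "s\<^sup>2 * (- q) = \<epsilon>\<^sup>2 + 1"
      using \<open>\<not> 0 \<le> q\<close> by (simp add: s_def field_simps)
    then show False
      using bound[of s] bound[of "- s"] by auto
  qed
  show "\<bar>b\<bar> \<le> \<epsilon> * sqrt q"
  proof (cases "q = 0")
    case True
    have "b = 0"
    proof (rule ccontr)
      assume "b \<noteq> 0"
      then show False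
        using bound[of "(\<epsilon>\<^sup>2 + 1) / b"] True by simp (smt (verit) zero_le_power2)
    qed
    then show ?thesis
      using True by simp
  next
    case False
    \<comment> \<open>The polynomial attains its maximum at \<open>s = b / q\<close>.\<close>
    then have "b\<^sup>2 \<le> \<epsilon>\<^sup>2 * q"
      using bound[of "b / q"] q by (simp add: field_simps power2_eq_square)
    then have "sqrt (b\<^sup>2) \<le> sqrt (\<epsilon>\<^sup>2 * q)"
      by (rule real_sqrt_le_mono)
    then show ?thesis
      using assms(1) by (simp add: real_sqrt_mult)
  qed
qed

text \<open>Finiteness of the norm at a single \<open>h\<close> forces the Dirichlet form to be nonnegative, by
  scaling \<open>f\<close> in the supremum.\<close>

lemma fluct_norm_bounds:
  fixes p :: "(int ^ 'n::finite) pmf" and f h :: "'n obs"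
  assumes "fluct_norm p \<rho> h < ereal \<epsilon>"
  shows "0 < \<epsilon>"
    and "f \<in> G_space \<rho> \<Longrightarrow> 0 \<le> dirichlet p \<rho> f"
    and "f \<in> G_space \<rho> \<Longrightarrow> \<bar>prod0 \<rho> h f\<bar> \<le> \<epsilon> * sqrt (dirichlet p \<rho> f)"
    and "\<bar>t_coeff \<rho> h $ k\<bar>
      \<le> \<epsilon> * sqrt (compressibility \<rho> * (axis k 1 \<bullet> (S_matrix p *v axis k 1)))"
proof -
  define T where "T = (\<lambda>\<alpha> :: real ^ 'n. 2 * (\<Sum>i\<in>UNIV. \<alpha> $ i * t_coeff \<rho> h $ i)
    - compressibility \<rho> * (\<alpha> \<bullet> (S_matrix p *v \<alpha>)))"
  define V where "V = (\<lambda>f. 2 * prod0 \<rho> h f - dirichlet p \<rho> f)"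
  have sq: "fluct_sq p \<rho> h = (SUP \<alpha>. ereal (T \<alpha>)) + (SUP f\<in>G_space \<rho>. ereal (V f))"
    by (simp add: fluct_sq_def T_def V_def dirichlet_def)
  have T: "ereal (T \<alpha>) \<le> (SUP \<alpha>. ereal (T \<alpha>))" for \<alpha>
    by (rule SUP_upper) simp
  have V: "ereal (V f) \<le> (SUP f\<in>G_space \<rho>. ereal (V f))" if "f \<in> G_space \<rho>" for f
    by (rule SUP_upper) (rule that)
  have T0: "0 \<le> (SUP \<alpha>. ereal (T \<alpha>))"
    using T[of 0] by (simp add: T_def zero_ereal_def)
  have "prod0 \<rho> g (\<lambda>_. 0) = 0" "dirichlet p \<rho> (\<lambda>_. 0) = 0" for g :: "'n obs"
    using prod0_scale_right[of \<rho> g 0 g] dirichlet_scale[of p \<rho> 0 g] by auto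
  then have V0: "0 \<le> (SUP f\<in>G_space \<rho>. ereal (V f))"
    using V[OF G_space_zero] by (simp add: V_def zero_ereal_def)
  have nonneg: "0 \<le> fluct_sq p \<rho> h"
    unfolding sq using T0 V0 by simp
  have "fluct_sq p \<rho> h \<noteq> \<infinity>"
    using assms by (auto simp: fluct_norm_def)
  then obtain c where c: "fluct_sq p \<rho> h = ereal c" "0 \<le> c"
    using nonneg by (cases "fluct_sq p \<rho> h") auto
  then have "sqrt c < \<epsilon>"
    using assms by (simp add: fluct_norm_def)
  then show \<epsilon>: "0 < \<epsilon>"
    using c(2) by (meson le_less_trans real_sqrt_ge_zero)
  have c_le: "c \<le> \<epsilon>\<^sup>2"
    using \<open>sqrt c < \<epsilon>\<close> c(2) by (metis less_eq_real_def real_sqrt_ge_zero real_sqrt_pow2 power_mono)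
  \<comment> \<open>Each supremum is nonnegative, hence bounded by their sum.\<close>
  have "(SUP \<alpha>. ereal (T \<alpha>)) \<le> fluct_sq p \<rho> h" "(SUP f\<in>G_space \<rho>. ereal (V f)) \<le> fluct_sq p \<rho> h"
    unfolding sq using T0 V0 by (simp_all add: add_increasing add_increasing2)
  then have Tc: "T \<alpha> \<le> c" and Vc: "f \<in> G_space \<rho> \<Longrightarrow> V f \<le> c" for \<alpha> f
    using order_trans[OF T[of \<alpha>], of c] order_trans[OF V[of f], of c] by (simp_all add: c(1))
  have fb: "2 * (s * prod0 \<rho> h f) - s\<^sup>2 * dirichlet p \<rho> f \<le> \<epsilon>\<^sup>2" if "f \<in> G_space \<rho>" for s f
    using Vc[OF G_space_scale[OF that, of s]] c_le
    by (simp add: V_def prod0_scale_right dirichlet_scale)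
  show "f \<in> G_space \<rho> \<Longrightarrow> 0 \<le> dirichlet p \<rho> f"
    using quadratic_bound(1)[OF _ fb] \<epsilon> by simp
  show "f \<in> G_space \<rho> \<Longrightarrow> \<bar>prod0 \<rho> h f\<bar> \<le> \<epsilon> * sqrt (dirichlet p \<rho> f)"
    using quadratic_bound(2)[OF _ fb] \<epsilon> by simp
  \<comment> \<open>Testing only multiples of the \<open>k\<close>-th basis vector isolates the
    \<open>k\<close>-th coefficient.\<close>
  have "2 * (s * t_coeff \<rho> h $ k)
      - s\<^sup>2 * (compressibility \<rho> * (axis k 1 \<bullet> (S_matrix p *v axis k 1))) \<le> \<epsilon>\<^sup>2" for s
  proof -
    have "(\<Sum>i\<in>UNIV. (s *\<^sub>R axis k 1 :: real ^ 'n) $ i * t_coeff \<rho> h $ i)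
        = (\<Sum>i\<in>UNIV. if i = k then s * t_coeff \<rho> h $ k else 0)"
      by (intro sum.cong) (auto simp: axis_def)
    then have "T (s *\<^sub>R axis k 1) = 2 * (s * t_coeff \<rho> h $ k)
      - s\<^sup>2 * (compressibility \<rho> * (axis k 1 \<bullet> (S_matrix p *v axis k 1)))"
      by (simp add: T_def matrix_vector_mult_scaleR power2_eq_square)
    then show ?thesis
      using Tc[of "s *\<^sub>R axis k 1"] c_le by simp
  qed
  then show "\<bar>t_coeff \<rho> h $ k\<bar>
      \<le> \<epsilon> * sqrt (compressibility \<rho> * (axis k 1 \<bullet> (S_matrix p *v axis k 1)))"
    using quadratic_bound(2) \<epsilon> by simp
qed

section \<open>Symmetry\<close>

text \<open>Closeness of \<open>g\<close> and \<open>gen p u\<close> is expressed through pairings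
  and first moments, whose bounds simply add up along a chain of approximations. Nonnegativity of
  the Dirichlet form is recorded too, as it comes from the same norm bound.\<close>

definition approx_preimage ::
    "(int ^ ('n::finite)) pmf \<Rightarrow> real \<Rightarrow> real \<Rightarrow> 'n obs \<Rightarrow> 'n obs \<Rightarrow> bool" where
  "approx_preimage p \<rho> \<epsilon> g u \<longleftrightarrow>
     u \<in> G_space \<rho> \<and> g \<in> G_space \<rho> \<and> gen p u \<in> G_space \<rho> \<and>
     (\<forall>f\<in>G_space \<rho>. 0 \<le> dirichlet p \<rho> f \<and>
        \<bar>prod0 \<rho> (\<lambda>\<xi>. g \<xi> + (- 1) * gen p u \<xi>) f\<bar> \<le> \<epsilon> * sqrt (dirichlet p \<rho> f)) \<and>
     (\<forall>k. \<bar>t_coeff \<rho> (\<lambda>\<xi>. g \<xi> + (- 1) * gen p u \<xi>) $ k\<bar>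
        \<le> \<epsilon> * sqrt (compressibility \<rho> * (axis k 1 \<bullet> (S_matrix p *v axis k 1))))"

lemma approx_preimage_exists:
  fixes p :: "(int ^ 'n::finite) pmf"
  assumes closure: "H_embed p \<rho> g \<in> H_closure p \<rho> (H_embed p \<rho> ` (gen p ` G_space \<rho>))"
    and \<epsilon>: "0 < \<epsilon>" and \<rho>: "0 \<le> \<rho>" "\<rho> \<le> 1"
  shows "\<exists>u. approx_preimage p \<rho> \<epsilon> g u"
proof -
  \<comment> \<open>One third for each link of the chain \<open>g\<close>, \<open>s n\<close>,
    \<open>v n\<close>, \<open>gen p u\<close>.\<close>
  define \<delta> where "\<delta> = \<epsilon> / 3"
  have \<delta>: "0 < \<delta>" "\<epsilon> = \<delta> + \<delta> + \<delta>"
    using \<epsilon> by (auto simp: \<delta>_def)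
  from closure \<delta>(1) obtain u where u: "u \<in> G_space \<rho>"
    and dist: "H_dist p \<rho> (H_embed p \<rho> g) (H_embed p \<rho> (gen p u)) < ereal \<delta>"
    unfolding H_closure_def by blast
  from dist obtain s v where s: "s \<in> H_embed p \<rho> g" and v: "v \<in> H_embed p \<rho> (gen p u)"
    and sv: "limsup (\<lambda>n. fluct_norm p \<rho> (\<lambda>\<xi>. s n \<xi> - v n \<xi>)) < ereal \<delta>"
    unfolding H_dist_def INF_less_iff by auto
  have "\<forall>\<^sub>F n in sequentially. fluct_norm p \<rho> (\<lambda>\<xi>. s n \<xi> - v n \<xi>) < ereal \<delta>"
    using sv by (rule Limsup_lessD)
  moreover have "\<forall>\<^sub>F n in sequentially. fluct_norm p \<rho> (\<lambda>\<xi>. g \<xi> - s n \<xi>) < ereal \<delta>"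
    using s \<delta>(1) by (intro order_tendstoD(2)[of _ 0]) (auto simp: H_embed_def fluct_rel_def zero_ereal_def)
  moreover have "\<forall>\<^sub>F n in sequentially. fluct_norm p \<rho> (\<lambda>\<xi>. gen p u \<xi> - v n \<xi>) < ereal \<delta>"
    using v \<delta>(1) by (intro order_tendstoD(2)[of _ 0]) (auto simp: H_embed_def fluct_rel_def zero_ereal_def)
  ultimately have "\<forall>\<^sub>F n in sequentially. fluct_norm p \<rho> (\<lambda>\<xi>. s n \<xi> - v n \<xi>) < ereal \<delta> \<and>
      fluct_norm p \<rho> (\<lambda>\<xi>. g \<xi> - s n \<xi>) < ereal \<delta> \<and> fluct_norm p \<rho> (\<lambda>\<xi>. gen p u \<xi> - v n \<xi>) < ereal \<delta>"
    by (intro eventually_conj)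
  then obtain n where n: "fluct_norm p \<rho> (\<lambda>\<xi>. s n \<xi> - v n \<xi>) < ereal \<delta>"
    "fluct_norm p \<rho> (\<lambda>\<xi>. g \<xi> - s n \<xi>) < ereal \<delta>" "fluct_norm p \<rho> (\<lambda>\<xi>. gen p u \<xi> - v n \<xi>) < ereal \<delta>"
    using eventually_happens'[OF sequentially_bot] by blast
  define h1 h2 h3 where "h1 = (\<lambda>\<xi>. g \<xi> - s n \<xi>)" and "h2 = (\<lambda>\<xi>. s n \<xi> - v n \<xi>)"
    and "h3 = (\<lambda>\<xi>. gen p u \<xi> - v n \<xi>)"
  \<comment> \<open>The relation \<open>fluct_rel\<close> only relates Cauchy sequences in
    \<open>G_space\<close>; an element of an embedded class thus certifies that the embedded
    function lies there.\<close>
  have G: "g \<in> G_space \<rho>" "s n \<in> G_space \<rho>" "v n \<in> G_space \<rho>" "gen p u \<in> G_space \<rho>"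
    using s v by (auto simp: H_embed_def fluct_rel_def fluct_Cauchy_def)
  have Gd: "(\<lambda>\<xi>. a \<xi> - b \<xi>) \<in> G_space \<rho>" if "a \<in> G_space \<rho>" "b \<in> G_space \<rho>" for a b
    using G_space_linear[OF that, of "- 1"] by simp
  have h: "centered \<rho> h1" "centered \<rho> h2" "centered \<rho> h3"
    unfolding h1_def h2_def h3_def by (intro G_space_centered Gd G)+
  then have h12: "centered \<rho> (\<lambda>\<xi>. h1 \<xi> + 1 * h2 \<xi>)"
    by (intro centered_linear)
  note loc = h(1,2,3)[THEN centered_local] h12[THEN centered_local]
  have split: "(\<lambda>\<xi>. g \<xi> + (- 1) * gen p u \<xi>) = (\<lambda>\<xi>. (h1 \<xi> + 1 * h2 \<xi>) + (- 1) * h3 \<xi>)"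
    by (simp add: h1_def h2_def h3_def)
  have p: "prod0 \<rho> (\<lambda>\<xi>. g \<xi> + (- 1) * gen p u \<xi>) f = prod0 \<rho> h1 f + 1 * prod0 \<rho> h2 f + (- 1) * prod0 \<rho> h3 f"
    if "f \<in> G_space \<rho>" for f
    unfolding split using loc G_space_centered[OF that]
    by (simp only: prod0_linear_left)
  have t: "t_coeff \<rho> (\<lambda>\<xi>. g \<xi> + (- 1) * gen p u \<xi>) $ k
      = t_coeff \<rho> h1 $ k + 1 * t_coeff \<rho> h2 $ k + (- 1) * t_coeff \<rho> h3 $ k" for k
    unfolding split using h h12 loc \<rho>
    by (simp only: t_coeff_eq_moment centered_linear moment_linear)
  note B = fluct_norm_bounds(2-)[OF n(2)[folded h1_def]] fluct_norm_bounds(2-)[OF n(1)[folded h2_def]]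
    fluct_norm_bounds(2-)[OF n(3)[folded h3_def]]
  have "approx_preimage p \<rho> \<epsilon> g u"
    unfolding approx_preimage_def
  proof (intro conjI ballI allI u G)
    fix f :: "'n obs" assume f: "f \<in> G_space \<rho>"
    show "0 \<le> dirichlet p \<rho> f"
      by (rule B(1)[OF f])
    show "\<bar>prod0 \<rho> (\<lambda>\<xi>. g \<xi> + (- 1) * gen p u \<xi>) f\<bar> \<le> \<epsilon> * sqrt (dirichlet p \<rho> f)"
      unfolding p[OF f] \<delta>(2) distrib_right using B(2)[OF f] B(5)[OF f] B(8)[OF f] by linarith
  next
    fix k
    show "\<bar>t_coeff \<rho> (\<lambda>\<xi>. g \<xi> + (- 1) * gen p u \<xi>) $ k\<bar>
      \<le> \<epsilon> * sqrt (compressibility \<rho> * (axis k 1 \<bullet> (S_matrix p *v axis k 1)))"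
      unfolding t \<delta>(2) distrib_right using B(3)[of k] B(6)[of k] B(9)[of k] by linarith
  qed
  then show ?thesis
    by blast
qed

section \<open>Pairings and first moments of currents corrected by gradients\<close>

definition gradient_defect :: "(int ^ ('n::finite)) pmf \<Rightarrow> real \<Rightarrow> real ^ 'n ^ 'n \<Rightarrow> 'n \<Rightarrow> 'n obs" where
  "gradient_defect p \<rho> D i \<xi> = norm_current p \<rho> i \<xi> -
     (\<Sum>j\<in>UNIV. D $ i $ j * (of_bool (\<xi> 0) - of_bool (\<xi> (axis j 1))))"

lemma gradient_defect_eq:
  "gradient_defect p \<rho> D i = (\<lambda>\<xi>. norm_current p \<rho> i \<xi> +
     (- 1) * (\<Sum>j\<in>UNIV. D $ i $ j * (of_bool (\<xi> 0) + (- 1) * of_bool (\<xi> (axis j 1)))))"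
  by (simp add: gradient_defect_def fun_eq_iff)

lemma local_fun_gradients:
  "local_fun (\<lambda>\<xi>. \<Sum>j\<in>I. c j * (of_bool (\<xi> (x j)) + (- 1) * of_bool (\<xi> (y j))))"
  by (intro local_fun_sum local_fun_mult local_fun_add local_fun_const local_fun_site)

text \<open>The gradients pair to zero with \<open>G_space\<close>, so the pairing does not see
  \<open>D\<close>.\<close>

lemma prod0_gradient_defect:
  assumes "finite (set_pmf p)" "f \<in> G_space \<rho>" "0 < \<rho>" "\<rho> < 1"
  shows "prod0 \<rho> (gradient_defect p \<rho> D i) f = prod0 \<rho> (norm_current p \<rho> i) f"
proof -
  have f: "centered \<rho> f"
    using assms(2) by (rule G_space_centered)
  have l: "local_fun (\<lambda>\<xi>. of_bool (\<xi> 0) + (- 1) * of_bool (\<xi> (axis j 1)))" for j :: 'a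
    by (intro local_fun_add local_fun_mult local_fun_const local_fun_site)
  have "prod0 \<rho> (\<lambda>\<xi>. of_bool (\<xi> 0) + (- 1) * of_bool (\<xi> (axis j 1))) f = 0" for j
    using assms f by (subst prod0_linear_left) (auto simp: prod0_site_G_space)
  then have zero: "prod0 \<rho> (\<lambda>\<xi>. \<Sum>j\<in>UNIV. D $ i $ j * (of_bool (\<xi> 0) + (- 1) * of_bool (\<xi> (axis j 1)))) f = 0"
    using f l by (subst prod0_sum_left) simp_all
  show ?thesis
    unfolding gradient_defect_eq zero
      prod0_linear_left[OF local_fun_norm_current[OF assms(1)] local_fun_gradients f] by simp
qed

text \<open>First moments do see \<open>D\<close>: the gradient along direction \<open>j\<close> has
  \<open>k\<close>-th moment minus the compressibility if \<open>j = k\<close> and zero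
  otherwise.\<close>

lemma t_coeff_gradient_defect:
  assumes fin: "finite (set_pmf p)" and "pmf p 0 = 0" and \<rho>: "0 \<le> \<rho>" "\<rho> \<le> 1"
    and g: "centered \<rho> (gradient_defect p \<rho> D i)"
  shows "t_coeff \<rho> (gradient_defect p \<rho> D i) $ k = compressibility \<rho> * (D $ i $ k - S_matrix p $ i $ k)"
proof -
  have l: "local_fun (\<lambda>\<xi>. of_bool (\<xi> 0) + (- 1) * of_bool (\<xi> (axis j 1)))" for j :: 'a
    by (intro local_fun_add local_fun_mult local_fun_const local_fun_site)
  have m: "moment \<rho> k (\<lambda>\<xi>. of_bool (\<xi> 0) + (- 1) * of_bool (\<xi> (axis j 1)))
      = (if j = k then - compressibility \<rho> else 0)" for j
    using \<rho> by (subst moment_linear) (auto simp: moment_site axis_def)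
  have "moment \<rho> k (\<lambda>\<xi>. \<Sum>j\<in>UNIV. D $ i $ j * (of_bool (\<xi> 0) + (- 1) * of_bool (\<xi> (axis j 1))))
      = (\<Sum>j\<in>UNIV. D $ i $ j * moment \<rho> k (\<lambda>\<xi>. of_bool (\<xi> 0) + (- 1) * of_bool (\<xi> (axis j 1))))"
    using l \<rho> by (intro moment_sum) auto
  also have "\<dots> = - compressibility \<rho> * D $ i $ k"
    unfolding m by (simp add: if_distrib cong: if_cong)
  finally have "moment \<rho> k (\<lambda>\<xi>. \<Sum>j\<in>UNIV. D $ i $ j * (of_bool (\<xi> 0) + (- 1) * of_bool (\<xi> (axis j 1))))
      = - compressibility \<rho> * D $ i $ k" .
  moreover have "moment \<rho> k (gradient_defect p \<rho> D i) = moment \<rho> k (norm_current p \<rho> i) + (- 1) *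
      moment \<rho> k (\<lambda>\<xi>. \<Sum>j\<in>UNIV. D $ i $ j * (of_bool (\<xi> 0) + (- 1) * of_bool (\<xi> (axis j 1))))"
    unfolding gradient_defect_eq
    by (rule moment_linear[OF local_fun_norm_current[OF fin] local_fun_gradients \<rho>])
  ultimately show ?thesis
    using moment_norm_current[OF assms(1-4)] t_coeff_eq_moment[OF g] by (simp add: algebra_simps)
qed

section \<open>Symmetry as the precision tends to zero\<close>

lemma eq_if_dist_le_multiples:
  fixes a b C :: real
  assumes "\<And>\<epsilon>. 0 < \<epsilon> \<Longrightarrow> \<epsilon> \<le> 1 \<Longrightarrow> \<bar>a - b\<bar> \<le> \<epsilon> * C"
  shows "a = b"
proof -
  have "((\<lambda>\<epsilon>. \<epsilon> * C) \<longlongrightarrow> 0 * C) (at_right 0)"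
    by (intro tendsto_intros)
  moreover have "\<forall>\<^sub>F \<epsilon> in at_right 0. \<bar>a - b\<bar> \<le> \<epsilon> * C"
    using eventually_at_right_less[of "0 :: real"] eventually_at_right_real[OF zero_less_one]
    by eventually_elim (use assms in auto)
  ultimately have "\<bar>a - b\<bar> \<le> 0 * C"
    by (intro tendsto_lowerbound) auto
  then show ?thesis
    by simp
qed

lemma fluct_decomposition_symmetric:
  fixes p :: "(int ^ 'n::finite) pmf"
  assumes fin: "finite (set_pmf p)" and p0: "pmf p 0 = 0" and \<rho>: "0 < \<rho>" "\<rho> < 1"
    and D: "fluct_decomposition p \<rho> D"
  shows "D $ i $ k = D $ k $ i"
proof -
  define g where "g = gradient_defect p \<rho> D"
  define w where "w = norm_current p \<rho>"
  define C where "C = (\<lambda>k. sqrt (compressibility \<rho> * (axis k 1 \<bullet> (S_matrix p *v axis k (1 :: real)))))"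
  define Q where "Q = dirichlet p \<rho>"
  have \<rho>': "0 \<le> \<rho>" "\<rho> \<le> 1"
    using \<rho> by auto
  have "H_embed p \<rho> (g j) \<in> H_closure p \<rho> (H_embed p \<rho> ` (gen p ` G_space \<rho>))" for j
    using D unfolding fluct_decomposition_def g_def gradient_defect_def[abs_def] by blast
  then have "\<forall>j \<epsilon>. \<exists>u. 0 < \<epsilon> \<longrightarrow> approx_preimage p \<rho> \<epsilon> (g j) u"
    using approx_preimage_exists[OF _ _ \<rho>'] by blast
  \<comment> \<open>One preimage for each direction and precision; \<open>U j 1\<close> will serve
    as a fixed reference.\<close>
  then obtain U where U: "\<forall>j \<epsilon>. 0 < \<epsilon> \<longrightarrow> approx_preimage p \<rho> \<epsilon> (g j) (U j \<epsilon>)"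
    by metis
  define r where "r = (\<lambda>j \<epsilon> \<xi>. g j \<xi> + (- 1) * gen p (U j \<epsilon>) \<xi>)"
  have UG: "U j \<epsilon> \<in> G_space \<rho>" and gG: "g j \<in> G_space \<rho>" and LG: "gen p (U j \<epsilon>) \<in> G_space \<rho>"
    and rb: "\<And>f. f \<in> G_space \<rho> \<Longrightarrow> \<bar>prod0 \<rho> (r j \<epsilon>) f\<bar> \<le> \<epsilon> * sqrt (Q f)"
    and rt: "\<And>k. \<bar>t_coeff \<rho> (r j \<epsilon>) $ k\<bar> \<le> \<epsilon> * C k"
    if "0 < \<epsilon>" for j \<epsilon>
    using U that unfolding approx_preimage_def r_def Q_def C_def by simp_all
  have Q0: "0 \<le> Q f" if "f \<in> G_space \<rho>" for f
    using U[rule_format, OF zero_less_one] that unfolding approx_preimage_def Q_def by simp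
  have r_split: "prod0 \<rho> (r j \<epsilon>) f = prod0 \<rho> (g j) f - prod0 \<rho> (gen p (U j \<epsilon>)) f"
    if "0 < \<epsilon>" "f \<in> G_space \<rho>" for j \<epsilon> f
    unfolding r_def
    using prod0_linear_left[OF centered_local[OF G_space_centered[OF gG[OF that(1)]]]
        centered_local[OF G_space_centered[OF LG[OF that(1)]]] G_space_centered[OF that(2)], where c = "- 1"]
    by simp
  have gw: "prod0 \<rho> (g j) f = prod0 \<rho> (w j) f" if "f \<in> G_space \<rho>" for j f
    unfolding g_def w_def using fin that \<rho> by (rule prod0_gradient_defect)
  \<comment> \<open>By \<open>rt\<close> the left side is of order \<epsilon>, so this expresses
    \<open>D\<close> through pairings of currents with preimages.\<close>
  have t_r: "t_coeff \<rho> (r j \<epsilon>) $ l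
      = compressibility \<rho> * (D $ j $ l - S_matrix p $ j $ l) + prod0 \<rho> (w l) (U j \<epsilon>)"
    if \<epsilon>: "0 < \<epsilon>" for j l \<epsilon>
  proof -
    have c: "centered \<rho> (g j)" "centered \<rho> (gen p (U j \<epsilon>))"
      using gG[OF \<epsilon>] LG[OF \<epsilon>] by (auto intro: G_space_centered)
    have "t_coeff \<rho> (r j \<epsilon>) $ l = t_coeff \<rho> (g j) $ l + (- 1) * t_coeff \<rho> (gen p (U j \<epsilon>)) $ l"
      unfolding r_def using c c[THEN centered_local] \<rho>'
      by (simp only: t_coeff_eq_moment centered_linear moment_linear)
    then show ?thesis
      using t_coeff_gradient_defect[OF fin p0 \<rho>' c(1)[unfolded g_def], of l]
        t_coeff_gen[OF fin p0 UG[OF \<epsilon>] \<rho>, of j l]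
      by (simp add: g_def w_def)
  qed
  \<comment> \<open>The current is even, so \<open>U j \<epsilon>\<close> may be reflected; then the
    current is replaced by the remainder plus \<open>gen p (U l \<epsilon>)\<close>.\<close>
  have current_split: "prod0 \<rho> (w l) (U j \<epsilon>)
      = prod0 \<rho> (r l \<epsilon>) (reflect (U j \<epsilon>)) + prod0 \<rho> (gen p (U l \<epsilon>)) (reflect (U j \<epsilon>))"
    if \<epsilon>: "0 < \<epsilon>" for j l \<epsilon>
    using r_split[OF \<epsilon> G_space_reflect[OF UG[OF \<epsilon>]], of l j] gw[OF G_space_reflect[OF UG[OF \<epsilon>]], of l j]
      prod0_norm_current_reflect[OF fin UG[OF \<epsilon>] \<rho>, of l j]
    by (simp add: w_def)
  \<comment> \<open>The constant must not depend on \<epsilon>. Hence \<open>U j \<epsilon>\<close>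
    is split into \<open>U j 1\<close> and a difference \<open>v\<close> with uniformly bounded
    Dirichlet form.\<close>
  have remainder: "\<bar>prod0 \<rho> (r l \<epsilon>) (reflect (U j \<epsilon>))\<bar> \<le> \<epsilon> * (2 + sqrt (Q (U j 1)))"
    if \<epsilon>: "0 < \<epsilon>" "\<epsilon> \<le> 1" for j l \<epsilon>
  proof -
    define v where "v = (\<lambda>\<xi>. U j \<epsilon> \<xi> + (- 1) * U j 1 \<xi>)"
    have v: "v \<in> G_space \<rho>"
      unfolding v_def by (intro G_space_linear UG \<epsilon> zero_less_one)
    have loc: "local_fun (U j \<epsilon>)" "local_fun (U j 1)"
      using UG[OF \<epsilon>(1)] UG[OF zero_less_one] by (auto simp: G_space_def)
    have "prod0 \<rho> (gen p v) v = prod0 \<rho> (gen p (U j \<epsilon>)) v + (- 1) * prod0 \<rho> (gen p (U j 1)) v"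
      unfolding v_def gen_linear[OF fin loc]
      using centered_local[OF G_space_centered[OF LG[OF \<epsilon>(1)]]]
        centered_local[OF G_space_centered[OF LG[OF zero_less_one]]] G_space_centered[OF v]
      unfolding v_def by (rule prod0_linear_left)
    \<comment> \<open>In the difference of the two remainders \<open>g j\<close> cancels and
      \<open>- gen p v\<close> is left. Their bounds give
      \<open>Q v \<le> (\<epsilon> + 1) * sqrt (Q v)\<close>, whence the constant 2.\<close>
    then have "Q v = prod0 \<rho> (r j \<epsilon>) v - prod0 \<rho> (r j 1) v"
      unfolding Q_def dirichlet_eq[OF fin G_space_centered[OF v]]
      using r_split[OF \<epsilon>(1) v, of j] r_split[OF zero_less_one v, of j] by simp
    then have "Q v \<le> \<epsilon> * sqrt (Q v) + sqrt (Q v)"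
      using rb[OF \<epsilon>(1) v, of j] rb[OF zero_less_one v, of j] by simp
    also have "\<dots> \<le> 2 * sqrt (Q v)"
      using \<epsilon> Q0[OF v] by (simp add: mult_left_le_one_le)
    finally have "sqrt (Q v) * sqrt (Q v) \<le> 2 * sqrt (Q v)"
      using Q0[OF v] by simp
    have Qv: "sqrt (Q v) \<le> 2"
    proof (cases "sqrt (Q v) = 0")
      case False
      then have "0 < sqrt (Q v)"
        using Q0[OF v] by (simp add: less_le)
      with \<open>sqrt (Q v) * sqrt (Q v) \<le> 2 * sqrt (Q v)\<close> show ?thesis
        by (rule mult_right_le_imp_le)
    qed simp
    have Qr: "Q (reflect f) = Q f" if "f \<in> G_space \<rho>" for f
      unfolding Q_def by (rule dirichlet_reflect[OF fin G_space_centered[OF that]])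
    have "reflect (U j \<epsilon>) = (\<lambda>\<xi>. reflect v \<xi> + 1 * reflect (U j 1) \<xi>)"
      by (simp add: v_def reflect_def fun_eq_iff)
    moreover have "local_fun (r l \<epsilon>)"
      unfolding r_def
      by (rule centered_local[OF G_space_centered[OF G_space_linear[OF gG[OF \<epsilon>(1)] LG[OF \<epsilon>(1)]]]])
    ultimately have "prod0 \<rho> (r l \<epsilon>) (reflect (U j \<epsilon>))
        = prod0 \<rho> (r l \<epsilon>) (reflect v) + 1 * prod0 \<rho> (r l \<epsilon>) (reflect (U j 1))"
      by (simp only: prod0_linear_right[OF G_space_centered[OF G_space_reflect[OF v]]
          G_space_centered[OF G_space_reflect[OF UG[OF zero_less_one]]]])
    moreover have "\<bar>prod0 \<rho> (r l \<epsilon>) (reflect v)\<bar> \<le> \<epsilon> * 2"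
      using rb[OF \<epsilon>(1) G_space_reflect[OF v], of l] mult_left_mono[OF Qv, of \<epsilon>] \<epsilon>(1)
      unfolding Qr[OF v] by linarith
    moreover have "\<bar>prod0 \<rho> (r l \<epsilon>) (reflect (U j 1))\<bar> \<le> \<epsilon> * sqrt (Q (U j 1))"
      using rb[OF \<epsilon>(1) G_space_reflect[OF UG[OF zero_less_one]], of l j] Qr[OF UG[OF zero_less_one], of j]
      by simp
    ultimately show ?thesis
      by (simp add: distrib_left)
  qed
  have S: "S_matrix p $ i $ k = S_matrix p $ k $ i"
    by (simp add: S_matrix_eq_sum[OF fin] mult_ac)
  have "compressibility \<rho> * D $ i $ k = compressibility \<rho> * D $ k $ i"
  proof (rule eq_if_dist_le_multiples)
    fix \<epsilon> :: real assume \<epsilon>: "0 < \<epsilon>" "\<epsilon> \<le> 1"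
    have "prod0 \<rho> (gen p (U k \<epsilon>)) (reflect (U i \<epsilon>)) = prod0 \<rho> (gen p (U i \<epsilon>)) (reflect (U k \<epsilon>))"
      using UG[OF \<epsilon>(1)] by (intro prod0_gen_reflect fin) (auto simp: G_space_def)
    \<comment> \<open>Subtracting the two instances of \<open>t_r\<close> cancels
      \<open>S_matrix\<close> and the symmetric form; two moment errors and two remainders are
      left.\<close>
    then show "\<bar>compressibility \<rho> * D $ i $ k - compressibility \<rho> * D $ k $ i\<bar>
        \<le> \<epsilon> * (C k + C i + (2 + sqrt (Q (U i 1))) + (2 + sqrt (Q (U k 1))))"
      using rt[OF \<epsilon>(1), of i k] rt[OF \<epsilon>(1), of k i] current_split[OF \<epsilon>(1), of k i]
        current_split[OF \<epsilon>(1), of i k] remainder[OF \<epsilon>, of k i] remainder[OF \<epsilon>, of i k]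
      unfolding t_r[OF \<epsilon>(1)] S right_diff_distrib distrib_left by linarith
  qed
  then show ?thesis
    using \<rho> by (simp add: compressibility_def)
qed

theorem theorem1:
  fixes p :: "(int ^ 'n::finite) pmf" and \<rho> :: real and D :: "real ^ 'n ^ 'n"
  assumes "finite (set_pmf p)"
    and "pmf p 0 = 0"
    and "group_closure {x. pmf p x + pmf p (- x) > 0} = UNIV"
    and "0 \<le> \<rho>" and "\<rho> \<le> 1"
    and "diffusion_coefficient p \<rho> D"
  shows "Finite_Cartesian_Product.transpose D = D"
proof -
  have "D $ i $ k = D $ k $ i" for i k
  proof (cases "\<rho> \<in> {0, 1}")
    case False
    then show ?thesis
      using assms by (intro fluct_decomposition_symmetric) (auto simp: diffusion_coefficient_def)
  next
    case True
    \<comment> \<open>At an endpoint the matrices at interior densities are symmetric, and equality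
      of two entries is preserved by the limit.\<close>
    then obtain E where E: "\<And>\<theta>. 0 < \<theta> \<Longrightarrow> \<theta> < 1 \<Longrightarrow> fluct_decomposition p \<theta> (E \<theta>)"
      and lim: "(E \<longlongrightarrow> D) (at \<rho> within {0<..<1})"
      using assms(6) unfolding diffusion_coefficient_def by blast
    have comp: "((\<lambda>\<theta>. E \<theta> $ a $ b) \<longlongrightarrow> D $ a $ b) (at \<rho> within {0<..<1})" for a b
      by (intro tendsto_vec_nth lim)
    have "\<forall>\<^sub>F \<theta> in at \<rho> within {0<..<1}. E \<theta> $ k $ i = E \<theta> $ i $ k"
      unfolding eventually_at_filter
      by (intro always_eventually) (auto intro: fluct_decomposition_symmetric[OF assms(1,2) _ _ E])
    then have "((\<lambda>\<theta>. E \<theta> $ i $ k) \<longlongrightarrow> D $ k $ i) (at \<rho> within {0<..<1})"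
      by (rule Lim_transform_eventually[OF comp])
    \<comment> \<open>The endpoint is a limit point of the open interval, so limits there are
      unique.\<close>
    moreover have "at \<rho> within {0<..<1} \<noteq> bot"
      using True by (auto simp: trivial_limit_within islimpt_greaterThanLessThan1 islimpt_greaterThanLessThan2)
    ultimately show ?thesis
      using tendsto_unique[OF _ comp] by simp
  qed
  then show ?thesis
    by (simp add: Finite_Cartesian_Product.transpose_def vec_eq_iff)
qed

end
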